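(* Let $T>0$ and let $\mathfrak{B}\colon\mathcal{C}^{1}([0,T])\to\mathbb{R}^{2}$ be either the periodic boundary operator $\mathfrak{B}(u)=(u(T)-u(0),\,u'(T)-u'(0))$ or the Neumann boundary operator $\mathfrak{B}(u)=(u'(0),\,u'(T))$. Let $a\colon[0,T]\to\mathbb{R}$ be a measurable and essentially bounded function such that: (i) there exists a finite number of points $$0=\tau_0\le\sigma_1<\tau_1<\sigma_2<\tau_2<\dots<\sigma_m<\tau_m\le\sigma_{m+1}=T$$ (with $m\ge1$) such that $a(t)>0$ for a.e. $t\in I_i^+=[\sigma_i,\tau_i]$, for $i=1,\dots,m$, and $a(t)\le0$ for a.e. $t\in I_i^-=[\tau_i,\sigma_{i+1}]$, for $i=0,\dots,m$; (ii) $\displaystyle\int_0^T a(t)\,\mathrm{d}t<0$. For $i=1,\dots,m$ let $$A_i=\min\left\{\|a\|_{L^1(t_1,t_2)}\colon [t_1,t_2]\subseteq I_i^+,\ t_2-t_1=\frac{\tau_i-\sigma_i}{4}\right\},$$ which is a well-defined positive number. Let $g\colon[0,+\infty[\to[0,+\infty[$ be a continuous function such that: (iii) $g(0)=0$ and $g(u)>0$ for $u>0$; (iv) $\displaystyle\lim_{u\to0^+}\frac{g(u)}{u}=0$ and $\displaystyle\lim_{\substack{u\to0^+\\ \omega\to1}}\frac{g(\omega u)}{g(u)}=1$; (v) $g$ is monotone non-decreasing on $[\hat R,+\infty[$, for some $\hat R>0$; (vi) $\displaystyle\liminf_{u\to+\infty}\frac{g(u)}{G(u)}>\frac{\|a^-\|_{L^\infty(0,T)}}{\min_{i=1,\dots,m}A_i}$,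 where $G(u)=\int_0^u g(s)\,\mathrm{d}s$. Then the boundary value problem $$\left(\frac{u'}{\sqrt{1-(u')^{2}}}\right)'+a(t)g(u)=0,\qquad \mathfrak{B}(u)=0,$$ admits at least one positive solution.
   Context: $a^-(t)=-\min\{a(t),0\}$ denotes the negative part of $a$. A solution of the boundary value problem is a continuously differentiable function $u\colon[0,T]\to\mathbb{R}$ such that $|u'(t)|<1$ for every $t\in[0,T]$, the map $t\mapsto u'(t)/\sqrt{1-(u'(t))^2}$ is absolutely continuous on $[0,T]$, the differential equation is satisfied for a.e. $t\in[0,T]$, and $\mathfrak{B}(u)=0$. A solution $u$ is positive if $u(t)>0$ for every $t\in[0,T]$. *)

theory Defs
  imports "HOL-Analysis.Analysis" "HOL-Probability.Essential_Supremum"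
begin

text \<open>Functions on \<open>[0,T]\<close> are total functions \<open>real \<Rightarrow> real\<close> of which only the values on \<open>[0,T]\<close>
  matter; accordingly derivatives are taken within \<open>[0,T]\<close>, so that they are one-sided at the two
  endpoints.\<close>

definition Icc_deriv :: "real \<Rightarrow> (real \<Rightarrow> real) \<Rightarrow> real \<Rightarrow> real" where
  "Icc_deriv T u t = vector_derivative u (at t within {0..T})"

definition C1_Icc :: "real \<Rightarrow> (real \<Rightarrow> real) \<Rightarrow> bool" where
  "C1_Icc T u \<longleftrightarrow> u differentiable_on {0..T} \<and> continuous_on {0..T} (Icc_deriv T u)"

definition periodic_op :: "real \<Rightarrow> (real \<Rightarrow> real) \<Rightarrow> real \<times> real" where
  "periodic_op T u = (u T - u 0, Icc_deriv T u T - Icc_deriv T u 0)"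

definition neumann_op :: "real \<Rightarrow> (real \<Rightarrow> real) \<Rightarrow> real \<times> real" where
  "neumann_op T u = (Icc_deriv T u 0, Icc_deriv T u T)"

text \<open>Absolute continuity of a point function; the library constant \<open>absolutely_continuous\<close> is
  about measures.\<close>

definition abs_continuous_Icc :: "real \<Rightarrow> real \<Rightarrow> (real \<Rightarrow> real) \<Rightarrow> bool" where
  "abs_continuous_Icc a b f \<longleftrightarrow>
    (\<forall>\<epsilon>>0. \<exists>\<delta>>0. \<forall>(n::nat) x y.
      (\<forall>i<n. a \<le> x i \<and> x i \<le> y i \<and> y i \<le> b) \<and>
      disjoint_family_on (\<lambda>i. {x i<..<y i}) {..<n} \<and>
      (\<Sum>i<n. y i - x i) < \<delta> \<longrightarrow>
      (\<Sum>i<n. \<bar>f (y i) - f (x i)\<bar>) < \<epsilon>)"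

text \<open>The nonlinearity \<open>g\<close> is given on \<open>[0,\<infinity>[\<close> only, hence the requirement \<open>0 \<le> u t\<close>, without which
  \<open>g (u t)\<close> would be meaningless.\<close>

definition is_solution ::
  "real \<Rightarrow> ((real \<Rightarrow> real) \<Rightarrow> real \<times> real) \<Rightarrow> (real \<Rightarrow> real) \<Rightarrow> (real \<Rightarrow> real) \<Rightarrow> (real \<Rightarrow> real) \<Rightarrow> bool"
where
  "is_solution T B a g u \<longleftrightarrow>
    C1_Icc T u \<and>
    (\<forall>t\<in>{0..T}. 0 \<le> u t) \<and>
    (\<forall>t\<in>{0..T}. \<bar>Icc_deriv T u t\<bar> < 1) \<and>
    (let \<phi>u' = (\<lambda>t. Icc_deriv T u t / sqrt (1 - (Icc_deriv T u t)\<^sup>2)) in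
      abs_continuous_Icc 0 T \<phi>u' \<and>
      (AE t\<in>{0..T} in lebesgue.
        \<exists>D. (\<phi>u' has_real_derivative D) (at t within {0..T}) \<and> D + a t * g (u t) = 0)) \<and>
    B u = (0, 0)"

definition is_positive_solution ::
  "real \<Rightarrow> ((real \<Rightarrow> real) \<Rightarrow> real \<times> real) \<Rightarrow> (real \<Rightarrow> real) \<Rightarrow> (real \<Rightarrow> real) \<Rightarrow> (real \<Rightarrow> real) \<Rightarrow> bool"
where
  "is_positive_solution T B a g u \<longleftrightarrow>
    is_solution T B a g u \<and> (\<forall>t\<in>{0..T}. u t > 0)"

definition L1_norm :: "real \<Rightarrow> real \<Rightarrow> (real \<Rightarrow> real) \<Rightarrow> real" where
  "L1_norm t1 t2 f = (LINT t:{t1<..<t2}|lebesgue. \<bar>f t\<bar>)"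

definition Linf_norm :: "real \<Rightarrow> real \<Rightarrow> (real \<Rightarrow> real) \<Rightarrow> ereal" where
  "Linf_norm t1 t2 f = esssup (lebesgue_on {t1<..<t2}) (\<lambda>t. ereal \<bar>f t\<bar>)"

definition neg_part :: "(real \<Rightarrow> real) \<Rightarrow> real \<Rightarrow> real" where
  "neg_part a t = - min (a t) 0"

text \<open>For \<open>s = \<sigma>\<^sub>i\<close> and \<open>r = \<tau>\<^sub>i\<close> the following is the number \<open>A\<^sub>i\<close>. The set is infinite in general,
  so its minimum is taken with \<open>Least\<close>; \<open>window_min\<close> below shows that the minimum is attained
  and positive.\<close>

definition window_norms :: "(real \<Rightarrow> real) \<Rightarrow> real \<Rightarrow> real \<Rightarrow> real set" where
  "window_norms a s r =
    {L1_norm t1 t2 a | t1 t2. {t1..t2} \<subseteq> {s..r} \<and> t2 - t1 = (r - s) / 4}"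

definition A_min :: "(real \<Rightarrow> real) \<Rightarrow> real \<Rightarrow> real \<Rightarrow> real" where
  "A_min a s r = (LEAST x. x \<in> window_norms a s r)"

lemma window_min:
  fixes a :: "real \<Rightarrow> real"
  assumes meas: "a \<in> borel_measurable (lebesgue_on {0..T})"
    and bdd: "AE t\<in>{0..T} in lebesgue. \<bar>a t\<bar> \<le> C"
    and sr: "0 \<le> s" "s < r" "r \<le> T"
    and pos: "AE t\<in>{s..r} in lebesgue. a t > 0"
  shows "A_min a s r \<in> window_norms a s r"
    and "\<And>x. x \<in> window_norms a s r \<Longrightarrow> A_min a s r \<le> x"
    and "0 < A_min a s r"
proof -
  define d where "d = (r - s) / 4"
  have d: "0 < d" "s \<le> r - d" using sr by (auto simp: d_def field_simps)
  have intT: "set_integrable lebesgue {0..T} (\<lambda>t. \<bar>a t\<bar>)"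
    unfolding set_integrable_def
  proof (rule Bochner_Integration.integrable_bound)
    show "integrable lebesgue (\<lambda>t. indicator {0..T} t *\<^sub>R C)"
      by (simp add: lmeasurable_iff_integrable[symmetric])
    have "a \<in> lebesgue_on {0..T} \<rightarrow>\<^sub>M borel" by fact
    then have "(\<lambda>t. \<bar>a t\<bar>) \<in> lebesgue_on {0..T} \<rightarrow>\<^sub>M borel" by measurable
    then show "(\<lambda>t. indicator {0..T} t *\<^sub>R \<bar>a t\<bar>) \<in> borel_measurable lebesgue"
      by (simp add: borel_measurable_restrict_space_iff)
    show "AE t in lebesgue. norm (indicator {0..T} t *\<^sub>R \<bar>a t\<bar>) \<le> norm (indicator {0..T} t *\<^sub>R C)"
      using bdd by eventually_elim (auto simp: indicator_def)
  qed
  have intW: "set_integrable lebesgue S (\<lambda>t. \<bar>a t\<bar>)" if "S \<subseteq> {s..r}" "S \<in> sets lebesgue" for S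
    using set_integrable_subset[OF intT that(2)] that sr by fastforce
  have L1: "L1_norm x y a = integral {x..y} (\<lambda>t. \<bar>a t\<bar>)" if "s \<le> x" "y \<le> r" for x y
  proof -
    have "L1_norm x y a = integral {x<..<y} (\<lambda>t. \<bar>a t\<bar>)"
      unfolding L1_norm_def
      by (rule set_lebesgue_integral_eq_integral(2), rule intW) (use that in auto)
    then show ?thesis by (simp add: integral_open_interval_real)
  qed
  define H where "H x = integral {s..x} (\<lambda>t. \<bar>a t\<bar>)" for x
  have hk: "(\<lambda>t. \<bar>a t\<bar>) integrable_on {s..r}"
    by (rule set_lebesgue_integral_eq_integral(1), rule intW) auto
  have contH: "continuous_on {s..r} H"
    unfolding H_def by (rule indefinite_integral_continuous_1[OF hk])
  have F: "L1_norm x (x + d) a = H (x + d) - H x" if "x \<in> {s..r - d}" for x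
  proof -
    have "(\<lambda>t. \<bar>a t\<bar>) integrable_on {s..x + d}"
      by (rule integrable_on_subinterval[OF hk]) (use that in auto)
    then have "integral {s..x} (\<lambda>t. \<bar>a t\<bar>) + integral {x..x + d} (\<lambda>t. \<bar>a t\<bar>) = H (x + d)"
      unfolding H_def
      by (intro Henstock_Kurzweil_Integration.integral_combine) (use that d in auto)
    then show ?thesis using L1[of x "x + d"] that d by (simp add: H_def)
  qed
  have contF: "continuous_on {s..r - d} (\<lambda>x. L1_norm x (x + d) a)"
  proof -
    have "continuous_on {s..r - d} (\<lambda>x. H (x + d) - H x)"
      by (intro continuous_intros continuous_on_compose2[OF contH]) (use d in auto)
    then show ?thesis by (rule continuous_on_eq) (use F in auto)
  qed
  have W: "window_norms a s r = (\<lambda>x. L1_norm x (x + d) a) ` {s..r - d}"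
  proof (intro equalityI subsetI)
    fix v assume "v \<in> window_norms a s r"
    then obtain t1 t2 where v: "v = L1_norm t1 t2 a" "{t1..t2} \<subseteq> {s..r}" "t2 - t1 = d"
      unfolding window_norms_def d_def by blast
    then have "t2 = t1 + d" "t1 \<in> {s..r - d}" using d by auto
    then show "v \<in> (\<lambda>x. L1_norm x (x + d) a) ` {s..r - d}" using v(1) by blast
  next
    fix v assume "v \<in> (\<lambda>x. L1_norm x (x + d) a) ` {s..r - d}"
    then obtain x where x: "v = L1_norm x (x + d) a" "x \<in> {s..r - d}" by blast
    then have "{x..x + d} \<subseteq> {s..r}" "(x + d) - x = (r - s) / 4" by (auto simp: d_def)
    then show "v \<in> window_norms a s r" unfolding window_norms_def x(1) by blast
  qed
  have Fpos: "0 < L1_norm x (x + d) a" if x: "x \<in> {s..r - d}" for x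
  proof -
    have sub: "{x<..<x + d} \<subseteq> {s..r}" using x by auto
    have int: "integrable lebesgue (\<lambda>t. indicator {x<..<x + d} t *\<^sub>R \<bar>a t\<bar>)"
      using intW[OF sub] by (simp add: set_integrable_def)
    have "L1_norm x (x + d) a \<noteq> 0"
    proof
      assume "L1_norm x (x + d) a = 0"
      then have "AE t in lebesgue. indicator {x<..<x + d} t *\<^sub>R \<bar>a t\<bar> = 0"
        using integral_nonneg_eq_0_iff_AE[OF int]
        unfolding L1_norm_def set_lebesgue_integral_def by simp
      with pos have "AE t in lebesgue. t \<notin> {x<..<x + d}"
        by eventually_elim (use sub in \<open>auto simp: indicator_def\<close>)
      then have "emeasure lebesgue {x<..<x + d} = 0"
        by (subst (asm) AE_iff_measurable[where N = "{x<..<x + d}"]) auto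
      then show False using d by simp
    qed
    moreover have "0 \<le> L1_norm x (x + d) a"
      unfolding L1_norm_def set_lebesgue_integral_def by (intro integral_nonneg_AE) auto
    ultimately show ?thesis by simp
  qed
  obtain x0 where x0: "x0 \<in> {s..r - d}"
    "\<And>x. x \<in> {s..r - d} \<Longrightarrow> L1_norm x0 (x0 + d) a \<le> L1_norm x (x + d) a"
    using continuous_attains_inf[OF _ _ contF] d by auto
  have eq: "A_min a s r = L1_norm x0 (x0 + d) a"
    unfolding A_min_def by (rule Least_equality) (use x0 W in auto)
  show "A_min a s r \<in> window_norms a s r" using eq x0 W by auto
  show "A_min a s r \<le> x" if "x \<in> window_norms a s r" for x using that eq x0 W by auto
  show "0 < A_min a s r" using eq Fpos x0 by simp
qed

end

theory Submission
  imports Defs "HOL-Complex_Analysis.Great_Picard"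
begin

text \<open>
  With \<open>w = u' / sqrt (1 - u'\<^sup>2)\<close> the equation is the planar system \<open>u' = w / sqrt (1 + w\<^sup>2)\<close>,
  \<open>w' = - a g(u)\<close>, and both boundary conditions ask for a zero of a planar map: the shooting map
  \<open>(u 0, w 0) \<mapsto> (u T - u 0, w T - w 0)\<close> in the periodic case, \<open>(u 0, w 0) \<mapsto> (w 0, w T)\<close> in the Neumann
  case. The right-hand side is extended to \<open>u < 0\<close> so that a maximum principle makes all solutions
  nonnegative (\<open>traj_nonneg\<close>); as \<open>g(x) = O(x)\<close> near \<open>0\<close>, the origin cannot be reached from
  elsewhere, and a nontrivial solution is even positive (\<open>traj_positive\<close>).

  The shooting map has a zero away from the origin because it winds differently around small and large
  circles. On a small circle \<open>g(x) = o(x)\<close> makes trajectories nearly straight. Wherever \<open>w 0\<close> is not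
  negligible it decides the direction in which \<open>u\<close> moves; elsewhere \<open>u\<close> is nearly constant, and regular
  oscillation of \<open>g\<close> together with the negative mean of \<open>a\<close> gives \<open>w T - w 0\<close> the sign of \<open>u 0\<close>. So the
  map never points against \<open>(w 0, u 0)\<close> (\<open>no_small_trajectory\<close>) and winds around the origin like this
  linear isomorphism. On a large circle it never points in the direction \<open>(0, 1)\<close>
  (\<open>no_large_trajectory\<close>) and does not wind at all. The reason is a balance of two effects. With
  \<open>N\<close> the supremum norm of the negative part of \<open>a\<close> and \<open>G\<close> the primitive of \<open>g\<close>, the quantity
  \<open>sqrt (1 + w\<^sup>2) - N G(u)\<close> cannot decrease along a trajectory with \<open>w < 0\<close>, nor increase along one with
  \<open>w > 0\<close>; if it exceeds \<open>1\<close> somewhere, \<open>w\<close> keeps its sign too long for the boundary condition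
  (\<open>energy_le_1\<close>). But on an interval of positivity with window constant \<open>A\<close> a large solution
  acquires \<open>\<bar>w\<bar> \<ge> A g(u)\<close> at some point, and the growth condition on \<open>g / G\<close> makes this larger than
  \<open>1 + N G(u)\<close>. The topological conclusion is \<open>planar_zero_in_annulus\<close>.

  As \<open>g\<close> is only continuous, solutions of initial value problems need not be unique and there is no
  shooting map in the strict sense. The argument is therefore carried out for the endpoints of Euler
  polygons, which depend continuously on the initial state, and transferred by compactness
  (\<open>euler_limit\<close>) in both directions: if Euler maps of arbitrarily fine mesh violated the condition on one
  of the circles, some trajectory would violate it too, and zeros of the Euler maps accumulate at
  initial states of solutions.\<close>

section \<open>A planar existence principle\<close>

text \<open>A planar version of Krasnosel'skii's fixed point theorem in a conical shell. If \<open>F\<close> had no zero in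
the annulus, its restrictions to the two boundary circles would be homotopic in the punctured plane.
On the inner circle \<open>F\<close> never points against the coordinate swap, so the segment from one to the
other avoids the origin; on the outer circle it never points in the direction \<open>(0, 1)\<close>, so it
contracts along segments to the constant \<open>(0, -1)\<close>. Hence the swap, a linear isomorphism, would be
null-homotopic on the circle, and the circle contractible.\<close>

lemma planar_zero_in_annulus:
  fixes F :: "real \<times> real \<Rightarrow> real \<times> real"
  assumes F: "continuous_on UNIV F" and r: "0 < r" "r \<le> R"
    and inner: "\<And>z c. norm z = r \<Longrightarrow> 0 \<le> c \<Longrightarrow> F z \<noteq> - c *\<^sub>R prod.swap z"
    and outer: "\<And>z c. norm z = R \<Longrightarrow> 0 \<le> c \<Longrightarrow> F z \<noteq> (0, c)"
  shows "\<exists>z. r \<le> norm z \<and> norm z \<le> R \<and> F z = 0"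
proof (rule ccontr)
  assume no_zero: "\<not> ?thesis"
  let ?S = "sphere (0 :: real \<times> real) 1" and ?X = "- {0 :: real \<times> real}"
  let ?hom = "homotopic_with_canon (\<lambda>_. True) ?S ?X"
  have contF: "continuous_on A (\<lambda>x. F (f x))" if "continuous_on A f" for A and f :: "'x::topological_space \<Rightarrow> real \<times> real"
    using continuous_on_compose2[OF F that] by simp
  have swap: "continuous_on A (\<lambda>x :: real \<times> real. prod.swap x)" for A
    by (simp add: prod.swap_def continuous_intros)
  \<comment> \<open>a segment meets the origin only if its end points are opposite\<close>
  have seg: "closed_segment p q \<subseteq> ?X" if "\<And>c. 0 \<le> c \<Longrightarrow> p \<noteq> - c *\<^sub>R q" "q \<noteq> 0" for p q :: "real \<times> real"
  proof
    fix x assume "x \<in> closed_segment p q"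
    then obtain s where s: "0 \<le> s" "s \<le> 1" "x = (1 - s) *\<^sub>R p + s *\<^sub>R q"
      unfolding closed_segment_def by blast
    have "x \<noteq> 0"
    proof
      assume "x = 0"
      with s that(2) have "s \<noteq> 1" by auto
      have "p = - (s / (1 - s)) *\<^sub>R q"
      proof -
        have "(1 - s) *\<^sub>R p = (1 - s) *\<^sub>R (- (s / (1 - s)) *\<^sub>R q)"
          using s(3) \<open>x = 0\<close> \<open>s \<noteq> 1\<close> by (simp add: eq_neg_iff_add_eq_0)
        then show ?thesis using \<open>s \<noteq> 1\<close> by (simp del: scaleR_scaleR scaleR_minus_left)
      qed
      with that(1)[of "s / (1 - s)"] s \<open>s \<noteq> 1\<close> show False by auto
    qed
    then show "x \<in> ?X" by simp
  qed
  have h1: "?hom (\<lambda>x. F (r *\<^sub>R x)) prod.swap"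
  proof (rule homotopic_with_linear)
    fix x assume "x \<in> ?S"
    then have x: "norm (r *\<^sub>R x) = r" "x \<noteq> 0" using r by auto
    show "closed_segment (F (r *\<^sub>R x)) (prod.swap x) \<subseteq> ?X"
    proof (rule seg)
      fix c :: real assume "0 \<le> c"
      then have "0 \<le> c / r" using r by simp
      from inner[OF x(1) this] show "F (r *\<^sub>R x) \<noteq> - c *\<^sub>R prod.swap x"
        using r by (cases x) simp
    qed (use x(2) in \<open>cases x; auto simp: zero_prod_def\<close>)
  qed (intro contF continuous_intros swap)+
  have h2: "?hom (\<lambda>x. F (R *\<^sub>R x)) (\<lambda>x. (0, -1))"
  proof (rule homotopic_with_linear)
    fix x assume "x \<in> ?S"
    then have x: "norm (R *\<^sub>R x) = R" using r by auto
    show "closed_segment (F (R *\<^sub>R x)) (0, -1) \<subseteq> ?X"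
      by (rule seg) (use outer[OF x] in \<open>auto simp: zero_prod_def\<close>)
  qed (intro contF continuous_intros)+
  have h3: "?hom (\<lambda>x. F (r *\<^sub>R x)) (\<lambda>x. F (R *\<^sub>R x))"
  proof -
    let ?h = "\<lambda>p :: real \<times> (real \<times> real). F (((1 - fst p) * r + fst p * R) *\<^sub>R snd p)"
    have "continuous_on ({0..1} \<times> ?S) ?h" by (intro contF continuous_intros)
    moreover have "?h p \<noteq> 0" if "p \<in> {0..1} \<times> ?S" for p
    proof -
      define \<rho> where "\<rho> = (1 - fst p) * r + fst p * R"
      have t: "0 \<le> fst p" "fst p \<le> 1" "norm (snd p) = 1" using that by auto
      have "\<rho> = r + fst p * (R - r)" "\<rho> = R - (1 - fst p) * (R - r)"
        by (auto simp: \<rho>_def algebra_simps)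
      moreover have "0 \<le> fst p * (R - r)" "0 \<le> (1 - fst p) * (R - r)" using t r by auto
      ultimately have "r \<le> \<rho>" "\<rho> \<le> R" by linarith+
      then have "r \<le> norm (\<rho> *\<^sub>R snd p)" "norm (\<rho> *\<^sub>R snd p) \<le> R" using t r by auto
      with no_zero show ?thesis unfolding \<rho>_def by blast
    qed
    ultimately have "continuous_map (prod_topology (top_of_set {0..1}) (top_of_set ?S)) (top_of_set ?X) ?h"
      by (simp add: Pi_iff)
    then show ?thesis
      unfolding homotopic_with_def by (intro exI[of _ ?h] conjI) simp_all
  qed
  have "?hom prod.swap (\<lambda>x. (0, -1))"
    by (rule homotopic_with_trans[OF homotopic_with_symD[OF h1] homotopic_with_trans[OF h3 h2]])
  then have "homotopic_with_canon (\<lambda>_. True) ?S ?S ((\<lambda>y. sgn (prod.swap y)) \<circ> prod.swap) ((\<lambda>y. sgn (prod.swap y)) \<circ> (\<lambda>x. (0, -1)))"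
  proof (rule homotopic_with_compose_continuous_left)
    have nz: "prod.swap x \<noteq> 0" if "x \<noteq> 0" for x :: "real \<times> real"
      using that by (cases x) (auto simp: zero_prod_def)
    from nz show "continuous_on ?X (\<lambda>y. sgn (prod.swap y))"
      by (intro continuous_intros swap) auto
    show "(\<lambda>y. sgn (prod.swap y)) \<in> ?X \<rightarrow> ?S"
      using nz by (simp add: Pi_iff norm_sgn del: swap_simp)
  qed
  then have "homotopic_with_canon (\<lambda>_. True) ?S ?S id (\<lambda>x. sgn (-1, 0))"
    by (rule homotopic_with_eq) (auto simp: sgn_div_norm)
  then have "contractible ?S" unfolding contractible_def by blast
  then show False by (simp add: contractible_sphere)
qed

section \<open>Indefinite integrals of bounded functions\<close>

text \<open>Lebesgue's differentiation theorem on the line. The library result for boxes gives the derivative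
from the right at almost every point; applied to the reflected function it gives the derivative from
the left.\<close>

lemma indefinite_integral_AE_derivative:
  fixes f :: "real \<Rightarrow> real"
  assumes f: "f integrable_on {0..T}"
  obtains N where "negligible N"
    "\<And>t. t \<in> {0<..<T} - N \<Longrightarrow> ((\<lambda>t. integral {0..t} f) has_real_derivative f t) (at t)"
proof -
  define f0 where "f0 t = (if t \<in> {0..T} then f t else 0)" for t
  have "f0 integrable_on UNIV"
    using f integrable_restrict_UNIV[of "{0..T}" f] by (simp add: f0_def[abs_def])
  then have f0: "f0 integrable_on cbox a b" for a b
    by (rule integrable_on_subcbox) simp
  have f1: "(\<lambda>t. f0 (- t)) integrable_on cbox a b" for a b
  proof -
    have "f0 integrable_on {- b..- a}" using f0[of "- b" "- a"] by simp
    then have "(\<lambda>t. f0 (- t)) integrable_on {- (- a)..- (- b)}" by (rule Henstock_Kurzweil_Integration.integrable_reflect_real[THEN iffD2])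
    then show ?thesis by simp
  qed
  obtain N1 where N1: "negligible N1" "\<And>x e. x \<notin> N1 \<Longrightarrow> 0 < e \<Longrightarrow>
      \<exists>d>0. \<forall>h. 0 < h \<and> h < d \<longrightarrow> norm (integral (cbox x (x + h *\<^sub>R One)) f0 /\<^sub>R h ^ DIM(real) - f0 x) < e"
    using integrable_ccontinuous_explicit[of f0, OF f0] by blast
  obtain N2 where N2: "negligible N2" "\<And>x e. x \<notin> N2 \<Longrightarrow> 0 < e \<Longrightarrow>
      \<exists>d>0. \<forall>h. 0 < h \<and> h < d \<longrightarrow> norm (integral (cbox x (x + h *\<^sub>R One)) (\<lambda>t. f0 (- t)) /\<^sub>R h ^ DIM(real) - f0 (- x)) < e"
    using integrable_ccontinuous_explicit[of "\<lambda>t. f0 (- t)", OF f1] by blast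
  have "negligible (uminus ` N2)"
    by (rule negligible_locally_Lipschitz_image[OF order_refl N2(1)])
      (rule exI[of _ UNIV], auto simp: dist_norm intro!: exI[of _ 1])
  with N1(1) have "negligible (N1 \<union> uminus ` N2)" by simp
  moreover have "((\<lambda>t. integral {0..t} f) has_real_derivative f t) (at t)"
    if t: "t \<in> {0<..<T} - (N1 \<union> uminus ` N2)" for t
    unfolding DERIV_def
  proof (rule LIM_I)
    fix e :: real assume "0 < e"
    have t': "0 < t" "t < T" "t \<notin> N1" "- t \<notin> N2" using t by (auto simp: image_iff)
    obtain d1 where d1: "0 < d1"
      "\<And>h. 0 < h \<Longrightarrow> h < d1 \<Longrightarrow> \<bar>integral {t..t + h} f0 / h - f0 t\<bar> < e"
      using N1(2)[OF t'(3) \<open>0 < e\<close>] by (auto simp: divide_inverse_commute)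
    obtain d2 where d2: "0 < d2"
      "\<And>h. 0 < h \<Longrightarrow> h < d2 \<Longrightarrow> \<bar>integral {- t..- t + h} (\<lambda>t. f0 (- t)) / h - f0 t\<bar> < e"
      using N2(2)[OF t'(4) \<open>0 < e\<close>] by (auto simp: divide_inverse_commute)
    have inc: "integral {0..y} f - integral {0..x} f = integral {x..y} f0"
      if "0 \<le> x" "x \<le> y" "y \<le> T" for x y
    proof -
      have "integral {0..x} f + integral {x..y} f = integral {0..y} f"
        by (rule Henstock_Kurzweil_Integration.integral_combine)
          (use that in \<open>auto intro: integrable_on_subinterval[OF f]\<close>)
      moreover have "integral {x..y} f0 = integral {x..y} f"
        by (rule integral_cong) (use that in \<open>auto simp: f0_def\<close>)
      ultimately show ?thesis by simp
    qed
    have "norm ((integral {0..t + h} f - integral {0..t} f) / h - f t) < e"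
      if h: "h \<noteq> 0" "norm (h - 0) < Min {d1, d2, t, T - t}" for h
    proof (cases "0 < h")
      case True
      then show ?thesis
        using d1(2)[of h] inc[of t "t + h"] t' h by (auto simp: f0_def)
    next
      case False
      have "integral {- t..- t + (- h)} (\<lambda>t. f0 (- t)) = integral {t + h..t} f0"
        using Henstock_Kurzweil_Integration.integral_reflect_real[where f = f0 and a = "t + h" and b = t] by (simp add: add.commute)
      then have "\<bar>integral {t + h..t} f0 / (- h) - f0 t\<bar> < e"
        using d2(2)[of "- h"] h False by auto
      moreover have "integral {t + h..t} f0 / (- h) = (integral {0..t + h} f - integral {0..t} f) / h"
        using inc[of "t + h" t] t' h False by (auto simp: field_simps)
      moreover have "f0 t = f t" using t' by (auto simp: f0_def)
      ultimately show ?thesis by simp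
    qed
    then show "\<exists>s>0. \<forall>h. h \<noteq> 0 \<and> norm (h - 0) < s \<longrightarrow>
        norm ((integral {0..t + h} f - integral {0..t} f) / h - f t) < e"
      using d1(1) d2(1) t' by (intro exI[of _ "Min {d1, d2, t, T - t}"]) auto
  qed
  ultimately show thesis by (rule that)
qed

lemma has_integral_abs_bound:
  fixes f :: "real \<Rightarrow> real"
  assumes "(f has_integral i) {s..t}" "s \<le> t" "\<And>r. r \<in> {s..t} \<Longrightarrow> \<bar>f r\<bar> \<le> B"
  shows "\<bar>i\<bar> \<le> B * (t - s)"
proof -
  have "0 \<le> B" using assms(2) assms(3)[of s] by auto
  from has_integral_bound_real[OF this finite.emptyI assms(1)] show ?thesis
    using assms(2,3) by simp
qed

text \<open>The chain rule for a function \<open>X\<close> that is only an indefinite integral, so that \<open>X\<close> need not be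
differentiable everywhere. The difference \<open>D\<close> of \<open>\<Phi> \<circ> X\<close> and the indefinite integral of
\<open>(\<Phi>' \<circ> X) * x\<close> nevertheless is differentiable at every point, with derivative \<open>0\<close>: near \<open>s\<close> both
agree with \<open>\<Phi>' (X s) * (X t - X s)\<close> up to a term that is small compared with \<open>\<bar>t - s\<bar>\<close>, because
\<open>X\<close> is Lipschitz.\<close>

lemma chain_rule_indefinite_integral:
  fixes x X \<Phi> \<Phi>' :: "real \<Rightarrow> real"
  assumes X: "\<And>s t. a \<le> s \<Longrightarrow> s \<le> t \<Longrightarrow> t \<le> b \<Longrightarrow> (x has_integral X t - X s) {s..t}"
    and K: "\<And>t. t \<in> {a..b} \<Longrightarrow> \<bar>x t\<bar> \<le> K"
    and \<Phi>: "\<And>v. (\<Phi> has_real_derivative \<Phi>' v) (at v)" "continuous_on UNIV \<Phi>'"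
    and ab: "a \<le> b"
  shows "((\<lambda>t. \<Phi>' (X t) * x t) has_integral \<Phi> (X b) - \<Phi> (X a)) {a..b}"
proof -
  have "0 \<le> \<bar>x a\<bar>" by simp
  also have "\<bar>x a\<bar> \<le> K" using K ab by auto
  finally have K0: "0 \<le> K" .
  have lip1: "\<bar>X t - X s\<bar> \<le> K * (t - s)" if "a \<le> s" "s \<le> t" "t \<le> b" for s t
    using has_integral_abs_bound[OF X[OF that], of K] K that by auto
  have lip: "\<bar>X t - X s\<bar> \<le> K * \<bar>t - s\<bar>" if "s \<in> {a..b}" "t \<in> {a..b}" for s t
    using lip1[of s t] lip1[of t s] that by (cases "s \<le> t") auto
  have contX: "continuous_on {a..b} X"
  proof (rule lipschitz_on_continuous_on)
    show "K-lipschitz_on {a..b} X"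
      by (rule lipschitz_onI) (use lip K0 in \<open>auto simp: dist_real_def abs_minus_commute\<close>)
  qed
  have cont: "continuous_on {a..b} (\<lambda>t. \<Phi>' (X t))"
    by (rule continuous_on_compose2[OF \<Phi>(2) contX]) simp
  define v where "v t = \<Phi>' (X t) * x t" for t
  have "x absolutely_integrable_on {a..b}"
    by (rule absolutely_integrable_integrable_bound[where g = "\<lambda>_. K"])
      (use K X[of a b] ab in \<open>auto simp: has_integral_iff\<close>)
  then have "v absolutely_integrable_on {a..b}"
    unfolding v_def
    by (intro absolutely_integrable_bounded_measurable_product_real compact_imp_bounded
        compact_continuous_image[OF cont] continuous_imp_measurable_on_sets_lebesgue cont) auto
  then have v: "v integrable_on {a..b}" using set_lebesgue_integral_eq_integral(1) by blast
  define D where "D t = \<Phi> (X t) - integral {a..t} v" for t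
  have D_inc: "\<bar>(integral {a..t} v - integral {a..s} v) - c * (X t - X s)\<bar> \<le> \<epsilon> * K * (t - s)"
    if st: "a \<le> s" "s \<le> t" "t \<le> b" and c: "\<And>r. r \<in> {s..t} \<Longrightarrow> \<bar>\<Phi>' (X r) - c\<bar> \<le> \<epsilon>" for s t c \<epsilon>
  proof -
    have "integral {a..s} v + integral {s..t} v = integral {a..t} v"
      by (rule Henstock_Kurzweil_Integration.integral_combine)
        (use st in \<open>auto intro: integrable_on_subinterval[OF v]\<close>)
    moreover have "v integrable_on {s..t}"
      by (rule integrable_on_subinterval[OF v]) (use st in auto)
    ultimately have "(v has_integral (integral {a..t} v - integral {a..s} v)) {s..t}"
      by (simp add: has_integral_iff algebra_simps)
    from has_integral_diff[OF this has_integral_mult_right[OF X[OF st], of c]]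
    have *: "((\<lambda>r. (\<Phi>' (X r) - c) * x r) has_integral
        (integral {a..t} v - integral {a..s} v) - c * (X t - X s)) {s..t}"
      by (simp add: v_def left_diff_distrib)
    have e0: "0 \<le> \<epsilon>" using c[of s] st by auto
    show ?thesis
    proof (rule has_integral_abs_bound[OF *])
      show "\<bar>(\<Phi>' (X r) - c) * x r\<bar> \<le> \<epsilon> * K" if "r \<in> {s..t}" for r
        unfolding abs_mult using c K e0 K0 st that by (intro mult_mono) auto
    qed (use st in auto)
  qed
  have "(D has_derivative (\<lambda>h. 0)) (at s within {a..b})" if s: "s \<in> {a..b}" for s
    unfolding has_derivative_within_alt
  proof (intro conjI allI impI)
    fix e :: real assume "0 < e"
    define \<epsilon> where "\<epsilon> = e / (2 * (K + 1))"
    have \<epsilon>: "0 < \<epsilon>" "2 * (\<epsilon> * K) \<le> e" using \<open>0 < e\<close> K0 by (auto simp: \<epsilon>_def field_simps)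
    obtain d1 where d1: "0 < d1" "\<And>y. \<bar>y - X s\<bar> < d1 \<Longrightarrow>
        \<bar>\<Phi> y - \<Phi> (X s) - \<Phi>' (X s) * (y - X s)\<bar> \<le> \<epsilon> * \<bar>y - X s\<bar>"
      using \<Phi>(1)[of "X s"] \<epsilon>(1) unfolding has_field_derivative_def has_derivative_within_alt
      by auto
    obtain d2 where d2: "0 < d2" "\<And>r. r \<in> {a..b} \<Longrightarrow> \<bar>r - s\<bar> < d2 \<Longrightarrow> \<bar>\<Phi>' (X r) - \<Phi>' (X s)\<bar> < \<epsilon>"
      using cont s \<epsilon>(1) unfolding continuous_on_iff dist_real_def by blast
    define d where "d = min d2 (d1 / (K + 1))"
    have "norm (D t - D s - 0) \<le> e * norm (t - s)" if t: "t \<in> {a..b}" "norm (t - s) < d" for t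
    proof -
      have "\<bar>X t - X s\<bar> \<le> K * \<bar>t - s\<bar>" using lip s t by auto
      also have "\<dots> < d1"
      proof -
        have "K * \<bar>t - s\<bar> \<le> (K + 1) * \<bar>t - s\<bar>" by (simp add: algebra_simps)
        also have "\<dots> < (K + 1) * (d1 / (K + 1))"
          using t K0 by (intro mult_strict_left_mono) (auto simp: d_def)
        also have "\<dots> = d1" using K0 by simp
        finally show ?thesis .
      qed
      finally have 1: "\<bar>\<Phi> (X t) - \<Phi> (X s) - \<Phi>' (X s) * (X t - X s)\<bar> \<le> \<epsilon> * (K * \<bar>t - s\<bar>)"
        using d1(2)[of "X t"] lip[OF s t(1)] \<epsilon>(1) by (smt (verit) mult_left_mono)
      have 2: "\<bar>(integral {a..t} v - integral {a..s} v) - \<Phi>' (X s) * (X t - X s)\<bar> \<le> \<epsilon> * K * \<bar>t - s\<bar>"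
      proof (cases "s \<le> t")
        case True
        then show ?thesis
          using D_inc[of s t "\<Phi>' (X s)" \<epsilon>] s t d2(2) by (force simp: d_def less_imp_le)
      next
        case False
        then have "\<bar>(integral {a..s} v - integral {a..t} v) - \<Phi>' (X s) * (X s - X t)\<bar> \<le> \<epsilon> * K * (s - t)"
          using s t d2(2) by (intro D_inc) (force simp: d_def less_imp_le)+
        then show ?thesis using False by (simp add: algebra_simps abs_if split: if_splits)
      qed
      have "\<bar>D t - D s\<bar> \<le> 2 * (\<epsilon> * K) * \<bar>t - s\<bar>"
        using 1 2 unfolding D_def by (simp add: algebra_simps)
      also have "\<dots> \<le> e * \<bar>t - s\<bar>" using \<epsilon>(2) by (intro mult_right_mono) auto
      finally show ?thesis by simp
    qed
    moreover have "0 < d" using d1 d2 K0 by (auto simp: d_def)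
    ultimately show "\<exists>d>0. \<forall>y\<in>{a..b}. norm (y - s) < d \<longrightarrow> norm (D y - D s - 0) \<le> e * norm (y - s)"
      by blast
  qed simp
  then obtain c where "\<forall>t\<in>{a..b}. D t = c"
    using has_derivative_zero_constant[of "{a..b}" D] by auto
  then have "D b = D a" using ab by auto
  then show ?thesis using v by (simp add: D_def has_integral_iff v_def[abs_def])
qed

text \<open>Gronwall's inequality in both time directions. Backwards in time it is the forward inequality for the
reflected function \<open>\<lambda>t. y (T - t)\<close>.\<close>

lemma gronwall_two_sided:
  fixes y :: "real \<Rightarrow> real"
  assumes y: "continuous_on {0..T} y" "\<And>t. t \<in> {0..T} \<Longrightarrow> 0 \<le> y t" and L: "0 \<le> L"
    and inc: "\<And>s t. 0 \<le> s \<Longrightarrow> s \<le> t \<Longrightarrow> t \<le> T \<Longrightarrow> \<bar>y t - y s\<bar> \<le> L * integral {s..t} y"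
    and st: "s \<in> {0..T}" "t \<in> {0..T}"
  shows "y t \<le> exp (L * T) * y s"
proof -
  have forward: "z t \<le> exp (L * T) * z s"
    if z: "continuous_on {0..T} z" "\<And>t. t \<in> {0..T} \<Longrightarrow> 0 \<le> z t"
      "\<And>t. s \<le> t \<Longrightarrow> t \<le> T \<Longrightarrow> z t - z s \<le> L * integral {s..t} z" and st: "0 \<le> s" "s \<le> t" "t \<le> T"
    for z s t
  proof -
    \<comment> \<open>the majorant of \<open>z\<close>, discounted exponentially, does not increase\<close>
    let ?D = "\<lambda>r. (z s + L * integral {s..r} z) * exp (- L * (r - s))"
    have zc: "continuous_on {s..T} z" using z(1) st by (auto intro: continuous_on_subset)
    have "?D t \<le> ?D s"
    proof (rule DERIV_nonpos_imp_decreasing_open[where f = ?D and a = s and b = t])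
      fix r assume r: "s < r" "r < t"
      have "((\<lambda>r. integral {s..r} z) has_real_derivative z r) (at r within {s..T})"
        using integral_has_real_derivative[OF zc] r st by auto
      then have "((\<lambda>r. integral {s..r} z) has_real_derivative z r) (at r)"
        using at_within_Icc_at[of s r T] r st by auto
      then have "(?D has_real_derivative
          (L * z r - L * (z s + L * integral {s..r} z)) * exp (- L * (r - s))) (at r)"
        by (auto intro!: derivative_eq_intros simp: algebra_simps)
      moreover have "L * z r \<le> L * (z s + L * integral {s..r} z)"
        using z(3)[of r] r st L by (intro mult_left_mono) auto
      ultimately show "\<exists>D. (?D has_real_derivative D) (at r) \<and> D \<le> 0"
        by (intro exI conjI) (auto simp: mult_le_0_iff)
    next
      have "continuous_on {s..t} (\<lambda>r. integral {s..r} z)"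
        by (rule indefinite_integral_continuous_1)
          (use zc st in \<open>auto intro!: integrable_continuous_real continuous_on_subset[OF zc]\<close>)
      then show "continuous_on {s..t} ?D" by (intro continuous_intros)
    qed (use st in auto)
    then have "(z s + L * integral {s..t} z) * exp (- L * (t - s)) \<le> z s" by simp
    then have "(z s + L * integral {s..t} z) * exp (- L * (t - s)) * exp (L * (t - s)) \<le> z s * exp (L * (t - s))"
      by (intro mult_right_mono) auto
    then have "z s + L * integral {s..t} z \<le> z s * exp (L * (t - s))"
      by (simp add: mult.assoc flip: exp_add)
    also have "\<dots> \<le> z s * exp (L * T)"
      using z(2)[of s] st L by (intro mult_left_mono) (auto intro: mult_left_mono)
    finally show ?thesis using z(3)[of t] st by (simp add: mult.commute)
  qed
  show ?thesis
  proof (cases "s \<le> t")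
    case True
    show ?thesis by (rule forward[OF y]) (use inc[of s] st True in \<open>auto simp: abs_le_iff\<close>)
  next
    case False
    have "continuous_on {0..T} (\<lambda>t. y (T - t))"
      by (rule continuous_on_compose2[OF y(1)]) (auto intro!: continuous_intros)
    moreover have "y (T - r) - y (T - (T - s)) \<le> L * integral {T - s..r} (\<lambda>t. y (T - t))"
      if "T - s \<le> r" "r \<le> T" for r
    proof -
      have "\<bar>y s - y (T - r)\<bar> \<le> L * integral {T - r..s} y"
        using inc[of "T - r" s] that st by auto
      moreover have "integral {T - s..r} (\<lambda>t. y (T - t)) = integral {T - r..s} y"
      proof -
        have 1: "continuous_on {T - r..s} y" using that st by (intro continuous_on_subset[OF y(1)]) auto
        have "((\<lambda>x. y (- 1 * x + T)) has_integral (integral {T - r..s} y) /\<^sub>R \<bar>-1\<bar> ^ DIM(real))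
            ((\<lambda>x. (1 / - 1) *\<^sub>R x + - ((1 / - 1) *\<^sub>R T)) ` cbox (T - r) s)"
          using has_integral_affinity[of y "integral {T - r..s} y" "T - r" s "-1" T]
            integrable_integral[OF integrable_continuous_real[OF 1]] by simp
        moreover have "(\<lambda>x. (1 / - 1) *\<^sub>R x + - ((1 / - 1) *\<^sub>R T)) ` cbox (T - r) s = {T - s..r}"
        proof -
          have "(\<lambda>x. (1 / - 1) *\<^sub>R x + - ((1 / - 1) *\<^sub>R T)) = (-) T" by (rule ext) simp
          then show ?thesis by (simp del: scaleR_conv_of_real real_scaleR_def)
        qed
        ultimately have "((\<lambda>x. y (T - x)) has_integral integral {T - r..s} y) {T - s..r}" by simp
        then show ?thesis by (rule integral_unique)
      qed
      ultimately show ?thesis by (simp add: abs_le_iff)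
    qed
    ultimately have "y (T - (T - t)) \<le> exp (L * T) * y (T - (T - s))"
      by (intro forward) (use y(2) st False in auto)
    then show ?thesis by simp
  qed
qed

section \<open>The Minkowski slope\<close>

text \<open>The inverse of the map \<open>s \<mapsto> s / sqrt (1 - s\<^sup>2)\<close> of the differential operator. With
\<open>w = u' / sqrt (1 - u'\<^sup>2)\<close> the equation becomes the system \<open>u' = mink_slope w\<close>, \<open>w' = - a g(u)\<close>, and
the constraint \<open>\<bar>u'\<bar> < 1\<close> is automatic.\<close>

definition mink_slope :: "real \<Rightarrow> real" where
  "mink_slope w = w / sqrt (1 + w\<^sup>2)"

lemma one_plus_square_pos [simp]:
  "0 < 1 + (w :: real)\<^sup>2" "0 \<le> 1 + w\<^sup>2" "1 + w\<^sup>2 \<noteq> 0" "\<not> 1 + w\<^sup>2 < 0" "\<not> 1 + w\<^sup>2 \<le> 0"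
proof -
  show "0 < 1 + w\<^sup>2" by (simp add: add_pos_nonneg)
  then show "0 \<le> 1 + w\<^sup>2" "1 + w\<^sup>2 \<noteq> 0" "\<not> 1 + w\<^sup>2 < 0" "\<not> 1 + w\<^sup>2 \<le> 0" by linarith+
qed

lemma abs_mink_slope_less_1: "\<bar>mink_slope w\<bar> < 1"
proof -
  have "sqrt (w\<^sup>2) < sqrt (1 + w\<^sup>2)" by (intro real_sqrt_less_mono) simp
  then have "\<bar>w\<bar> < sqrt (1 + w\<^sup>2)" unfolding real_sqrt_abs .
  moreover have "0 < sqrt (1 + w\<^sup>2)" by simp
  ultimately show ?thesis unfolding mink_slope_def by (simp add: abs_divide)
qed

lemma abs_mink_slope_le: "\<bar>mink_slope w\<bar> \<le> \<bar>w\<bar>"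
proof -
  have "1 \<le> sqrt (1 + w\<^sup>2)" by simp
  then have "\<bar>w\<bar> / sqrt (1 + w\<^sup>2) \<le> \<bar>w\<bar> / 1" by (intro divide_left_mono) auto
  then show ?thesis by (simp add: mink_slope_def abs_divide)
qed

lemma mink_slope_sgn:
  "0 < mink_slope w \<longleftrightarrow> 0 < w" "mink_slope w < 0 \<longleftrightarrow> w < 0" "mink_slope w = 0 \<longleftrightarrow> w = 0"
  "0 \<le> mink_slope w \<longleftrightarrow> 0 \<le> w" "mink_slope w \<le> 0 \<longleftrightarrow> w \<le> 0"
proof -
  have s: "0 < sqrt (1 + w\<^sup>2)" by simp
  show "0 < mink_slope w \<longleftrightarrow> 0 < w" "mink_slope w < 0 \<longleftrightarrow> w < 0" "mink_slope w = 0 \<longleftrightarrow> w = 0"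
    "0 \<le> mink_slope w \<longleftrightarrow> 0 \<le> w" "mink_slope w \<le> 0 \<longleftrightarrow> w \<le> 0"
    using s unfolding mink_slope_def
    by (auto simp: zero_less_divide_iff divide_less_0_iff zero_le_divide_iff divide_le_0_iff simp del: real_sqrt_gt_0_iff)
qed

lemma continuous_on_mink_slope [continuous_intros]:
  "continuous_on S f \<Longrightarrow> continuous_on S (\<lambda>x. mink_slope (f x))"
  unfolding mink_slope_def
  by (intro continuous_intros) auto

lemma mink_slope_inverse: "mink_slope w / sqrt (1 - (mink_slope w)\<^sup>2) = w"
proof -
  have "1 - (mink_slope w)\<^sup>2 = 1 / (1 + w\<^sup>2)"
    by (simp add: mink_slope_def power_divide field_simps)
  then have "sqrt (1 - (mink_slope w)\<^sup>2) = 1 / sqrt (1 + w\<^sup>2)" by (simp add: real_sqrt_divide)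
  then show ?thesis
    by (simp add: mink_slope_def)
qed

text \<open>Up to a constant, \<open>sqrt (1 + w\<^sup>2)\<close> is the kinetic energy of the system.\<close>

lemma sqrt_energy_derivative:
  "((\<lambda>w. sqrt (1 + w\<^sup>2)) has_real_derivative mink_slope w) (at w)"
  unfolding mink_slope_def by (auto intro!: derivative_eq_intros simp: field_simps)

section \<open>The first-order system and its Euler polygons\<close>

text \<open>The function that follows \<open>F k\<close> on the \<open>k\<close>-th cell of a grid of mesh \<open>h\<close>. The value at the right
end of a cell comes from the next cell, which does not affect the integral.\<close>

lemma step_function_has_integral:
  fixes F :: "nat \<Rightarrow> real \<Rightarrow> real"
  assumes h: "0 < h" and F: "\<And>k. k < n \<Longrightarrow> (F k has_integral I k) {real k * h..real (Suc k) * h}"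
  shows "((\<lambda>s. F (nat \<lfloor>s / h\<rfloor>) s) has_integral (\<Sum>k<n. I k)) {0..real n * h}"
  using F
proof (induction n)
  case 0
  then show ?case using has_integral_refl(2)[of "\<lambda>s. F (nat \<lfloor>s / h\<rfloor>) s" "0 :: real"] by simp
next
  case (Suc n)
  have "(F n has_integral I n) {real n * h..real (Suc n) * h}" by (rule Suc.prems) simp
  then have "((\<lambda>s. F (nat \<lfloor>s / h\<rfloor>) s) has_integral I n) {real n * h..real (Suc n) * h}"
  proof (rule has_integral_spike_finite[where S = "{real (Suc n) * h}", rotated 2])
    fix s assume s: "s \<in> {real n * h..real (Suc n) * h} - {real (Suc n) * h}"
    then have "real n \<le> s / h" "s / h < real (Suc n)" using h by (auto simp: field_simps)
    then have "\<lfloor>s / h\<rfloor> = int n" by (intro floor_unique) auto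
    then show "F (nat \<lfloor>s / h\<rfloor>) s = F n s" by simp
  qed simp
  moreover have "((\<lambda>s. F (nat \<lfloor>s / h\<rfloor>) s) has_integral (\<Sum>k<n. I k)) {0..real n * h}"
    by (rule Suc.IH) (use Suc.prems in simp)
  ultimately have "((\<lambda>s. F (nat \<lfloor>s / h\<rfloor>) s) has_integral (\<Sum>k<n. I k) + I n) {0..real (Suc n) * h}"
    using h by (intro has_integral_combine[where c = "real n * h"]) auto
  then show ?case by simp
qed

text \<open>The weight is bounded everywhere and not just almost everywhere; a change of the weight on a null set
achieves this.\<close>

locale mink_system =
  fixes T C :: real and a g :: "real \<Rightarrow> real"
  assumes T_pos: "0 < T"
    and a_meas: "a \<in> borel_measurable (lebesgue_on {0..T})"
    and a_le: "t \<in> {0..T} \<Longrightarrow> \<bar>a t\<bar> \<le> C"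
    and g_cont: "continuous_on {0..} g"
    and g_zero: "g 0 = 0"
    and g_pos: "0 < x \<Longrightarrow> 0 < g x"
begin

text \<open>The nonlinearity is extended to negative arguments so that the equation reads \<open>w' = - a g(u)\<close> for
\<open>u \<ge> 0\<close> and \<open>w' = - g(-u)\<close> for \<open>u < 0\<close>. Where \<open>u\<close> is negative it is strictly concave, and this forces
solutions of the boundary value problem to be nonnegative.\<close>

definition gpos :: "real \<Rightarrow> real" where "gpos x = g (max x 0)"
definition gneg :: "real \<Rightarrow> real" where "gneg x = g (max (- x) 0)"

definition force :: "real \<Rightarrow> real \<Rightarrow> real" where
  "force t x = a t * gpos x + gneg x"

text \<open>Solutions of the system in integral form. The second component starts at \<open>w 0\<close> and loses the integral
of the force.\<close>

definition trajectory :: "(real \<Rightarrow> real) \<Rightarrow> (real \<Rightarrow> real) \<Rightarrow> bool" where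
  "trajectory u w \<longleftrightarrow> continuous_on {0..T} u \<and> continuous_on {0..T} w \<and>
    (\<forall>t\<in>{0..T}. ((\<lambda>s. mink_slope (w s)) has_integral u t - u 0) {0..t} \<and>
                ((\<lambda>s. force s (u s)) has_integral w 0 - w t) {0..t})"

lemma C_nonneg: "0 \<le> C"
  using a_le[of 0] T_pos by auto

lemma g_nonneg: "0 \<le> x \<Longrightarrow> 0 \<le> g x"
  using g_pos[of x] g_zero by (cases "x = 0") auto

lemma gpos_simps: "0 \<le> x \<Longrightarrow> gpos x = g x" "x \<le> 0 \<Longrightarrow> gpos x = 0"
  by (auto simp: gpos_def g_zero max_def)

lemma gneg_simps: "0 \<le> x \<Longrightarrow> gneg x = 0" "x \<le> 0 \<Longrightarrow> gneg x = g (- x)"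
  by (auto simp: gneg_def g_zero max_def)

lemma continuous_on_gpos [continuous_intros]:
  "continuous_on S f \<Longrightarrow> continuous_on S (\<lambda>x. gpos (f x))"
  unfolding gpos_def by (intro continuous_on_compose2[OF g_cont] continuous_intros) auto

lemma continuous_on_gneg [continuous_intros]:
  "continuous_on S f \<Longrightarrow> continuous_on S (\<lambda>x. gneg (f x))"
  unfolding gneg_def by (intro continuous_on_compose2[OF g_cont] continuous_intros) auto

lemma abs_force_le: "t \<in> {0..T} \<Longrightarrow> \<bar>force t x\<bar> \<le> max C 1 * g \<bar>x\<bar>"
proof -
  assume t: "t \<in> {0..T}"
  have g: "0 \<le> g \<bar>x\<bar>" by (simp add: g_nonneg)
  show ?thesis
  proof (cases "0 \<le> x")
    case True
    then have "\<bar>force t x\<bar> = \<bar>a t\<bar> * g \<bar>x\<bar>"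
      using g by (simp add: force_def gpos_simps gneg_simps abs_mult)
    also have "\<dots> \<le> max C 1 * g \<bar>x\<bar>" using a_le[OF t] g by (intro mult_right_mono) auto
    finally show ?thesis .
  next
    case False
    then have "\<bar>force t x\<bar> = 1 * g \<bar>x\<bar>"
      using g by (simp add: force_def gpos_simps gneg_simps)
    also have "\<dots> \<le> max C 1 * g \<bar>x\<bar>" using g by (intro mult_right_mono) auto
    finally show ?thesis .
  qed
qed

lemma weight_times_continuous_integrable:
  assumes "continuous_on {s..t} v" "0 \<le> s" "t \<le> T"
  shows "(\<lambda>r. a r * v r) integrable_on {s..t}"
proof -
  have "a \<in> borel_measurable (lebesgue_on {s..t})"
    by (rule measurable_restrict_mono[OF a_meas]) (use assms in auto)
  then have "a absolutely_integrable_on {s..t}"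
    using measurable_bounded_by_integrable_imp_absolutely_integrable[of a "{s..t}" "\<lambda>_. C"] a_le assms
    by auto
  then have "(\<lambda>r. v r * a r) absolutely_integrable_on {s..t}"
    by (intro absolutely_integrable_bounded_measurable_product_real compact_imp_bounded
        compact_continuous_image[OF assms(1)] continuous_imp_measurable_on_sets_lebesgue assms(1)) auto
  then show ?thesis
    using set_lebesgue_integral_eq_integral(1) by (simp add: mult.commute) blast
qed

lemma weight_integrable: "0 \<le> s \<Longrightarrow> t \<le> T \<Longrightarrow> a integrable_on {s..t}"
  using weight_times_continuous_integrable[of s t "\<lambda>_. 1"] by simp

lemma force_integrable:
  assumes "continuous_on {s..t} v" "0 \<le> s" "t \<le> T"
  shows "(\<lambda>r. force r (v r)) integrable_on {s..t}"
  unfolding force_def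
  by (intro integrable_add weight_times_continuous_integrable integrable_continuous_real
      continuous_intros assms)

lemma force_bound: obtains K where "0 \<le> K" "\<And>t x. t \<in> {0..T} \<Longrightarrow> \<bar>x\<bar> \<le> R \<Longrightarrow> \<bar>force t x\<bar> \<le> K"
proof -
  have "bounded (g ` {0..max R 0})"
    by (intro compact_imp_bounded compact_continuous_image continuous_on_subset[OF g_cont]) auto
  then obtain M where "\<forall>y\<in>g ` {0..max R 0}. norm y \<le> M"
    unfolding bounded_iff by blast
  then have M: "\<bar>g x\<bar> \<le> M" if "x \<in> {0..max R 0}" for x using that by simp
  have "0 \<le> M" using M[of 0] by (auto intro: order_trans[OF abs_ge_zero])
  show thesis
  proof (rule that)
    show "0 \<le> max C 1 * M" using \<open>0 \<le> M\<close> by simp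
    fix t x :: real assume t: "t \<in> {0..T}" and x: "\<bar>x\<bar> \<le> R"
    have "g \<bar>x\<bar> \<le> M" using M[of "\<bar>x\<bar>"] x by auto
    then have "max C 1 * g \<bar>x\<bar> \<le> max C 1 * M" by (intro mult_left_mono) auto
    with abs_force_le[OF t, of x] show "\<bar>force t x\<bar> \<le> max C 1 * M" by simp
  qed
qed

text \<open>Explicit Euler steps for the system. The weight is merely measurable, so each step uses its exact
integral over the cell. The map depends continuously on the initial point \<open>z\<close>, which may fail for the
system itself because \<open>g\<close> is not assumed Lipschitz and initial value problems may have several
solutions.\<close>

primrec euler :: "real \<Rightarrow> real \<times> real \<Rightarrow> nat \<Rightarrow> real \<times> real" where
  "euler h z 0 = z"
| "euler h z (Suc k) =
    (fst (euler h z k) + h * mink_slope (snd (euler h z k)),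
     snd (euler h z k) - (integral {real k * h..real (Suc k) * h} a * gpos (fst (euler h z k))
       + h * gneg (fst (euler h z k))))"

lemma continuous_on_euler: "continuous_on UNIV (\<lambda>z. euler h z k)"
  by (induction k) (auto intro!: continuous_intros)

text \<open>The Euler steps interpolated by an exact solution \<open>u\<close>, \<open>w\<close> of the system in which the right-hand side
is evaluated at the step functions \<open>us\<close>, \<open>ws\<close> instead of \<open>u\<close>, \<open>w\<close>. The Lipschitz constants depend
neither on the mesh nor on the starting point in the ball of radius \<open>R\<close>.\<close>

lemma euler_polygon:
  assumes n: "0 < n" and z: "norm z \<le> R"
    and K: "0 \<le> K" "\<And>t x. t \<in> {0..T} \<Longrightarrow> \<bar>x\<bar> \<le> R + T \<Longrightarrow> \<bar>force t x\<bar> \<le> K"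
  obtains u w us ws where "u 0 = fst z" "w 0 = snd z" "(u T, w T) = euler (T / real n) z n"
    "\<And>t. t \<in> {0..T} \<Longrightarrow> ((\<lambda>s. mink_slope (ws s)) has_integral u t - u 0) {0..t}"
    "\<And>t. t \<in> {0..T} \<Longrightarrow> ((\<lambda>s. force s (us s)) has_integral w 0 - w t) {0..t}"
    "\<And>t. t \<in> {0..T} \<Longrightarrow> \<bar>us t\<bar> \<le> R + T"
    "\<And>t. t \<in> {0..T} \<Longrightarrow> \<bar>u t - us t\<bar> \<le> T / real n"
    "\<And>t. t \<in> {0..T} \<Longrightarrow> \<bar>w t - ws t\<bar> \<le> K * (T / real n)"
    "\<And>s t. s \<in> {0..T} \<Longrightarrow> t \<in> {0..T} \<Longrightarrow> \<bar>u t - u s\<bar> \<le> \<bar>t - s\<bar>"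
    "\<And>s t. s \<in> {0..T} \<Longrightarrow> t \<in> {0..T} \<Longrightarrow> \<bar>w t - w s\<bar> \<le> K * \<bar>t - s\<bar>"
proof -
  define h where "h = T / real n"
  have h: "0 < h" "real n * h = T" using T_pos n by (auto simp: h_def)
  define U where "U k = fst (euler h z k)" for k
  define W where "W k = snd (euler h z k)" for k
  have U_Suc: "U (Suc k) - U k = h * mink_slope (W k)" for k by (simp add: U_def W_def)
  have W_Suc: "W k - W (Suc k) = integral {real k * h..real (Suc k) * h} a * gpos (U k) + h * gneg (U k)"
    for k by (simp add: U_def W_def)
  have U_bound: "\<bar>U k\<bar> \<le> R + real k * h" for k
  proof (induction k)
    case 0
    have "\<bar>fst z\<bar> \<le> norm z" by (metis norm_fst_le prod.collapse real_norm_def)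
    then show ?case using z by (simp add: U_def)
  next
    case (Suc k)
    have "\<bar>h * mink_slope (W k)\<bar> \<le> h * 1"
      unfolding abs_mult using h abs_mink_slope_less_1[of "W k"] by (intro mult_mono) auto
    then show ?case using Suc U_Suc[of k] by (simp add: algebra_simps)
  qed
  define idx where "idx s = nat \<lfloor>s / h\<rfloor>" for s
  have idx: "real (idx t) * h \<le> t" "t - real (idx t) * h \<le> h" "idx t \<le> n" if "t \<in> {0..T}" for t
  proof -
    have "0 \<le> t / h" using that h by simp
    then have r: "real (idx t) = of_int \<lfloor>t / h\<rfloor>" by (simp add: idx_def)
    have "real (idx t) \<le> t / h" "t / h \<le> real (idx t) + 1" unfolding r by linarith+
    then show 1: "real (idx t) * h \<le> t" "t - real (idx t) * h \<le> h" using h by (auto simp: field_simps)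
    have "real (idx t) * h \<le> real n * h" using 1 that h by simp
    then show "idx t \<le> n" using h(1) by (simp add: mult_le_cancel_right)
  qed
  define us where "us s = U (idx s)" for s
  define ws where "ws s = W (idx s)" for s
  have grid: "real k * h \<le> T" if "k \<le> n" for k
  proof -
    have "real k * h \<le> real n * h" using that h by (intro mult_right_mono) auto
    then show ?thesis using h by simp
  qed
  have int_u: "((\<lambda>s. mink_slope (ws s)) has_integral U k - U 0) {0..real k * h}" for k
  proof -
    have "((\<lambda>s. mink_slope (ws s)) has_integral (\<Sum>k<k. h * mink_slope (W k))) {0..real k * h}"
      unfolding ws_def idx_def
    proof (rule step_function_has_integral[where F = "\<lambda>k s. mink_slope (W k)", OF h(1)])
      fix k
      show "((\<lambda>s. mink_slope (W k)) has_integral h * mink_slope (W k)) {real k * h..real (Suc k) * h}"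
        using has_integral_const_real[of "mink_slope (W k)" "real k * h" "real (Suc k) * h"] h
        by (simp add: algebra_simps)
    qed
    then show ?thesis by (simp flip: U_Suc add: sum_lessThan_telescope)
  qed
  have int_w: "((\<lambda>s. force s (us s)) has_integral W 0 - W k) {0..real k * h}" if "k \<le> n" for k
  proof -
    have "((\<lambda>s. force s (us s)) has_integral (\<Sum>k<k. W k - W (Suc k))) {0..real k * h}"
      unfolding us_def idx_def
    proof (rule step_function_has_integral[where F = "\<lambda>k s. force s (U k)", OF h(1)])
      fix j assume "j < k"
      then have "real (Suc j) * h \<le> T" using that by (intro grid) auto
      then have "a integrable_on {real j * h..real (Suc j) * h}"
        using h by (intro weight_integrable) auto
      then have "((\<lambda>s. a s * gpos (U j)) has_integral integral {real j * h..real (Suc j) * h} a * gpos (U j))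
          {real j * h..real (Suc j) * h}"
        by (intro has_integral_mult_left integrable_integral)
      moreover have "((\<lambda>s. gneg (U j)) has_integral h * gneg (U j)) {real j * h..real (Suc j) * h}"
        using has_integral_const_real[of "gneg (U j)" "real j * h" "real (Suc j) * h"] h
        by (simp add: algebra_simps)
      ultimately show "((\<lambda>s. force s (U j)) has_integral W j - W (Suc j)) {real j * h..real (Suc j) * h}"
        unfolding W_Suc force_def by (rule has_integral_add)
    qed
    then show ?thesis by (simp add: sum_lessThan_telescope')
  qed
  define u where "u t = U 0 + integral {0..t} (\<lambda>s. mink_slope (ws s))" for t
  define w where "w t = W 0 - integral {0..t} (\<lambda>s. force s (us s))" for t
  have iu: "(\<lambda>s. mink_slope (ws s)) integrable_on {s..t}" if "0 \<le> s" "t \<le> T" for s t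
    by (rule integrable_on_subinterval[OF has_integral_integrable[OF int_u[of n]]]) (use that h in auto)
  have iw: "(\<lambda>s. force s (us s)) integrable_on {s..t}" if "0 \<le> s" "t \<le> T" for s t
    by (rule integrable_on_subinterval[OF has_integral_integrable[OF int_w[of n]]]) (use that h in auto)
  have u0: "u 0 = U 0" "w 0 = W 0" by (auto simp: u_def w_def)
  have us_bound: "\<bar>us t\<bar> \<le> R + T" if "t \<in> {0..T}" for t
    using U_bound[of "idx t"] grid[OF idx(3)[OF that]] by (simp add: us_def)
  have lip_u1: "\<bar>u t - u s\<bar> \<le> 1 * (t - s)" if "0 \<le> s" "s \<le> t" "t \<le> T" for s t
  proof (rule has_integral_abs_bound)
    have "integral {0..s} (\<lambda>s. mink_slope (ws s)) + integral {s..t} (\<lambda>s. mink_slope (ws s)) = integral {0..t} (\<lambda>s. mink_slope (ws s))"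
      by (rule Henstock_Kurzweil_Integration.integral_combine) (use that iu in auto)
    then show "((\<lambda>s. mink_slope (ws s)) has_integral u t - u s) {s..t}"
      using iu[of s t] that by (simp add: u_def has_integral_iff)
  qed (use that abs_mink_slope_less_1 in \<open>auto intro: less_imp_le\<close>)
  have lip_w1: "\<bar>w s - w t\<bar> \<le> K * (t - s)" if "0 \<le> s" "s \<le> t" "t \<le> T" for s t
  proof (rule has_integral_abs_bound)
    have "integral {0..s} (\<lambda>s. force s (us s)) + integral {s..t} (\<lambda>s. force s (us s)) = integral {0..t} (\<lambda>s. force s (us s))"
      by (rule Henstock_Kurzweil_Integration.integral_combine) (use that iw in auto)
    then show "((\<lambda>s. force s (us s)) has_integral w s - w t) {s..t}"
      using iw[of s t] that by (simp add: w_def has_integral_iff)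
  qed (use that K us_bound in auto)
  have u_grid: "u (real k * h) = U k" for k
    using int_u[of k] by (simp add: u_def integral_unique)
  have w_grid: "w (real k * h) = W k" if "k \<le> n" for k
    using int_w[OF that] by (simp add: w_def integral_unique)
  have int_ut: "((\<lambda>s. mink_slope (ws s)) has_integral u t - u 0) {0..t}" if "t \<in> {0..T}" for t
    using iu[of 0 t] that unfolding u0 by (simp add: u_def has_integral_iff)
  have int_wt: "((\<lambda>s. force s (us s)) has_integral w 0 - w t) {0..t}" if "t \<in> {0..T}" for t
    using iw[of 0 t] that unfolding u0 by (simp add: w_def has_integral_iff)
  have close_u: "\<bar>u t - us t\<bar> \<le> h" and close_w: "\<bar>w t - ws t\<bar> \<le> K * h" if t: "t \<in> {0..T}" for t
  proof -
    have "0 \<le> real (idx t) * h" using h by simp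
    note i = this idx[OF t]
    show "\<bar>u t - us t\<bar> \<le> h"
      using lip_u1[of "real (idx t) * h" t] i t u_grid[of "idx t"] by (simp add: us_def)
    have "K * (t - real (idx t) * h) \<le> K * h" using i K by (intro mult_left_mono) auto
    then show "\<bar>w t - ws t\<bar> \<le> K * h"
      using lip_w1[of "real (idx t) * h" t] i t w_grid[of "idx t"]
      by (simp add: ws_def abs_minus_commute)
  qed
  have lip_u: "\<bar>u t - u s\<bar> \<le> \<bar>t - s\<bar>" and lip_w: "\<bar>w t - w s\<bar> \<le> K * \<bar>t - s\<bar>"
    if "s \<in> {0..T}" "t \<in> {0..T}" for s t
    using lip_u1[of s t] lip_u1[of t s] lip_w1[of s t] lip_w1[of t s] that
    by (cases "s \<le> t"; auto simp: abs_minus_commute)+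
  have ends: "u 0 = fst z" "w 0 = snd z" "(u T, w T) = euler (T / real n) z n"
    using u_grid[of n] w_grid[of n] h by (simp_all add: u0 U_def W_def flip: h_def)
  show thesis
    by (rule that[OF ends int_ut int_wt us_bound close_u[unfolded h_def] close_w[unfolded h_def] lip_u lip_w])
qed

text \<open>Compactness: a closed relation between initial and final state that is met by Euler polygons of
arbitrarily fine mesh is met by a trajectory. The interpolated polygons are uniformly bounded and
equi-Lipschitz, so by Arzela and Ascoli a subsequence converges uniformly; the step functions have
the same limit, and dominated convergence passes to the limit in the integral equations.\<close>

lemma euler_limit:
  fixes P :: "((real \<times> real) \<times> (real \<times> real)) set"
  assumes P: "closed P"
    and freq: "\<And>N. \<exists>n\<ge>N. \<exists>z. norm z \<le> R \<and> (z, euler (T / real n) z n) \<in> P"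
  obtains u w where "trajectory u w" "((u 0, w 0), (u T, w T)) \<in> P"
proof -
  obtain K where K: "0 \<le> K" "\<And>t x. t \<in> {0..T} \<Longrightarrow> \<bar>x\<bar> \<le> R + T \<Longrightarrow> \<bar>force t x\<bar> \<le> K"
    using force_bound[of "R + T"] by blast
  have "\<forall>j. \<exists>n z. Suc j \<le> n \<and> norm z \<le> R \<and> (z, euler (T / real n) z n) \<in> P" using freq by blast
  then obtain n z where nz: "\<And>j :: nat. Suc j \<le> n j" "\<And>j. norm (z j) \<le> R"
    "\<And>j. (z j, euler (T / real (n j)) (z j) (n j)) \<in> P" by metis
  define good where "good j = (\<lambda>(u, w, us, ws). u 0 = fst (z j) \<and> w 0 = snd (z j) \<and>
    (u T, w T) = euler (T / real (n j)) (z j) (n j) \<and>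
    (\<forall>t\<in>{0..T}. ((\<lambda>s. mink_slope (ws s)) has_integral u t - u 0) {0..t} \<and>
       ((\<lambda>s. force s (us s)) has_integral w 0 - w t) {0..t} \<and> \<bar>us t\<bar> \<le> R + T \<and>
       \<bar>u t - us t\<bar> \<le> T / real (n j) \<and> \<bar>w t - ws t\<bar> \<le> K * (T / real (n j))) \<and>
    (\<forall>s\<in>{0..T}. \<forall>t\<in>{0..T}. \<bar>u t - u s\<bar> \<le> \<bar>t - s\<bar> \<and> \<bar>w t - w s\<bar> \<le> K * \<bar>t - s\<bar>))" for j
  have "\<exists>p. good j p" for j
  proof -
    have "0 < n j" using nz(1)[of j] by simp
    from this nz(2)[of j] K show ?thesis
    proof (rule euler_polygon)
      fix u w us ws
      assume "u 0 = fst (z j)" "w 0 = snd (z j)" "(u T, w T) = euler (T / real (n j)) (z j) (n j)"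
        "\<And>t. t \<in> {0..T} \<Longrightarrow> ((\<lambda>s. mink_slope (ws s)) has_integral u t - u 0) {0..t}"
        "\<And>t. t \<in> {0..T} \<Longrightarrow> ((\<lambda>s. force s (us s)) has_integral w 0 - w t) {0..t}"
        "\<And>t. t \<in> {0..T} \<Longrightarrow> \<bar>us t\<bar> \<le> R + T"
        "\<And>t. t \<in> {0..T} \<Longrightarrow> \<bar>u t - us t\<bar> \<le> T / real (n j)"
        "\<And>t. t \<in> {0..T} \<Longrightarrow> \<bar>w t - ws t\<bar> \<le> K * (T / real (n j))"
        "\<And>s t. s \<in> {0..T} \<Longrightarrow> t \<in> {0..T} \<Longrightarrow> \<bar>u t - u s\<bar> \<le> \<bar>t - s\<bar>"
        "\<And>s t. s \<in> {0..T} \<Longrightarrow> t \<in> {0..T} \<Longrightarrow> \<bar>w t - w s\<bar> \<le> K * \<bar>t - s\<bar>"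
      then have "good j (u, w, us, ws)" unfolding good_def by blast
      then show ?thesis by blast
    qed
  qed
  then obtain p where p: "\<And>j. good j (p j)" by metis
  define u where "u j = fst (p j)" for j
  define w where "w j = fst (snd (p j))" for j
  define us where "us j = fst (snd (snd (p j)))" for j
  define ws where "ws j = snd (snd (snd (p j)))" for j
  have ends: "u j 0 = fst (z j)" "w j 0 = snd (z j)" "(u j T, w j T) = euler (T / real (n j)) (z j) (n j)" for j
    using p[of j] by (auto simp: good_def u_def w_def case_prod_beta)
  have pt: "((\<lambda>s. mink_slope (ws j s)) has_integral u j t - u j 0) {0..t}"
    "((\<lambda>s. force s (us j s)) has_integral w j 0 - w j t) {0..t}" "\<bar>us j t\<bar> \<le> R + T"
    "\<bar>u j t - us j t\<bar> \<le> T / real (n j)" "\<bar>w j t - ws j t\<bar> \<le> K * (T / real (n j))" if "t \<in> {0..T}" for j t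
    using p[of j] that by (auto simp: good_def u_def w_def us_def ws_def case_prod_beta)
  have lip: "\<bar>u j t - u j s\<bar> \<le> \<bar>t - s\<bar>" "\<bar>w j t - w j s\<bar> \<le> K * \<bar>t - s\<bar>"
    if "s \<in> {0..T}" "t \<in> {0..T}" for j s t
    using p[of j] that by (auto simp: good_def u_def w_def case_prod_beta)
  have zb: "\<bar>fst (z j)\<bar> \<le> R" "\<bar>snd (z j)\<bar> \<le> R" for j
    using nz(2)[of j] norm_fst_le[of "fst (z j)" "snd (z j)"] norm_snd_le[of "snd (z j)" "fst (z j)"] by auto
  let ?F = "\<lambda>j t. (u j t, w j t)"
  have close: "norm (?F j s - ?F j t) \<le> (1 + K) * \<bar>s - t\<bar>" if "s \<in> {0..T}" "t \<in> {0..T}" for j s t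
    using lip[of t s j] that norm_Pair_le[of "u j s - u j t" "w j s - w j t"]
    by (simp add: algebra_simps)
  obtain G k where G: "continuous_on {0..T} G" "strict_mono (k :: nat \<Rightarrow> nat)"
    "\<And>e. 0 < e \<Longrightarrow> \<exists>N. \<forall>j t. N \<le> j \<and> t \<in> {0..T} \<longrightarrow> norm (?F (k j) t - G t) < e"
  proof (rule Arzela_Ascoli[of "{0..T}" ?F "2 * R + (1 + K) * T"])
    fix j t assume t: "t \<in> {0..T}"
    have "norm (?F j t) \<le> norm (?F j 0) + norm (?F j t - ?F j 0)" by (rule norm_triangle_sub)
    moreover have "norm (?F j 0) \<le> 2 * R"
      using norm_Pair_le[of "u j 0" "w j 0"] zb[of j] by (simp add: ends)
    moreover have "norm (?F j t - ?F j 0) \<le> (1 + K) * T"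
    proof (rule order_trans[OF close])
      show "(1 + K) * \<bar>t - 0\<bar> \<le> (1 + K) * T" using t K(1) by (intro mult_left_mono) auto
    qed (use t T_pos in auto)
    ultimately show "norm (?F j t) \<le> 2 * R + (1 + K) * T" by simp
  next
    fix t e :: real assume t: "t \<in> {0..T}" and e: "0 < e"
    have "norm (?F j t - ?F j s) < e" if "s \<in> {0..T}" "norm (t - s) < e / (1 + K)" for j s
    proof -
      have "(1 + K) * \<bar>t - s\<bar> < (1 + K) * (e / (1 + K))"
        using that(2) K(1) by (intro mult_strict_left_mono) auto
      then show ?thesis using close[OF t that(1), of j] K(1) by simp
    qed
    moreover have "0 < e / (1 + K)" using e K(1) by simp
    ultimately show "\<exists>d>0. \<forall>j s. s \<in> {0..T} \<and> norm (t - s) < d \<longrightarrow> norm (?F j t - ?F j s) < e"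
      by blast
  qed (auto intro: that)
  define v where "v t = fst (G t)" for t
  define y where "y t = snd (G t)" for t
  have lim: "(\<lambda>j. ?F (k j) t) \<longlonglongrightarrow> G t" if "t \<in> {0..T}" for t
    by (rule LIMSEQ_I) (use G(3) that in blast)
  have lim_v: "(\<lambda>j. u (k j) t) \<longlonglongrightarrow> v t" and lim_y: "(\<lambda>j. w (k j) t) \<longlonglongrightarrow> y t"
    if "t \<in> {0..T}" for t
    using tendsto_fst[OF lim[OF that]] tendsto_snd[OF lim[OF that]] by (simp_all add: v_def y_def)
  have n_lim: "(\<lambda>j. T / real (n (k j))) \<longlonglongrightarrow> 0"
  proof (rule tendsto_sandwich[OF _ _ tendsto_const])
    have "T / real (n (k j)) \<le> T / real (Suc j)" for j
    proof -
      have "Suc j \<le> n (k j)" using nz(1)[of "k j"] seq_suble[OF G(2), of j] by simp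
      then show ?thesis using T_pos by (intro divide_left_mono) auto
    qed
    then show "\<forall>\<^sub>F j in sequentially. T / real (n (k j)) \<le> T / real (Suc j)" by simp
    show "(\<lambda>j. T / real (Suc j)) \<longlonglongrightarrow> 0"
      using LIMSEQ_Suc[OF lim_const_over_n[of T]] by simp
  qed (use T_pos in simp)
  have lim_us: "(\<lambda>j. us (k j) t) \<longlonglongrightarrow> v t" if t: "t \<in> {0..T}" for t
  proof -
    have "(\<lambda>j. u (k j) t - us (k j) t) \<longlonglongrightarrow> 0"
      by (rule Lim_null_comparison[OF _ n_lim]) (use pt(4)[OF t] in simp)
    from tendsto_diff[OF lim_v[OF t] this] show ?thesis by simp
  qed
  have lim_ws: "(\<lambda>j. ws (k j) t) \<longlonglongrightarrow> y t" if t: "t \<in> {0..T}" for t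
  proof -
    have "(\<lambda>j. w (k j) t - ws (k j) t) \<longlonglongrightarrow> 0"
      by (rule Lim_null_comparison[OF _ tendsto_mult_right_zero[OF n_lim, of K]]) (use pt(5)[OF t] in simp)
    from tendsto_diff[OF lim_y[OF t] this] show ?thesis by simp
  qed
  have cont: "continuous_on {0..T} v" "continuous_on {0..T} y"
    unfolding v_def y_def by (intro continuous_intros G(1))+
  have slope_lim: "(\<lambda>j. mink_slope (f j)) \<longlonglongrightarrow> mink_slope l" if "f \<longlonglongrightarrow> l" for f l
    by (rule isCont_tendsto_compose[OF _ that])
      (use continuous_on_mink_slope[OF continuous_on_id, of UNIV] in \<open>simp add: continuous_on_eq_continuous_at\<close>)
  have force_lim: "(\<lambda>j. force t (f j)) \<longlonglongrightarrow> force t l" if "f \<longlonglongrightarrow> l" for f l t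
  proof (rule isCont_tendsto_compose[OF _ that])
    have "continuous_on UNIV (force t)"
      unfolding force_def[abs_def] by (intro continuous_intros)
    then show "isCont (force t) l" by (simp add: continuous_on_eq_continuous_at)
  qed
  have "((\<lambda>s. mink_slope (y s)) has_integral v t - v 0) {0..t}" if t: "t \<in> {0..T}" for t
  proof -
    have "(\<lambda>s. mink_slope (y s)) integrable_on {0..t}"
      by (intro integrable_continuous_real continuous_intros continuous_on_subset[OF cont(2)]) (use t in auto)
    moreover have "(\<lambda>j. integral {0..t} (\<lambda>s. mink_slope (ws (k j) s))) \<longlonglongrightarrow> integral {0..t} (\<lambda>s. mink_slope (y s))"
      by (rule dominated_convergence(2)[where h = "\<lambda>_. 1"])
        (use pt(1)[OF t] abs_mink_slope_less_1 t in \<open>auto intro!: slope_lim lim_ws intro: less_imp_le\<close>)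
    moreover have "(\<lambda>j. integral {0..t} (\<lambda>s. mink_slope (ws (k j) s))) \<longlonglongrightarrow> v t - v 0"
      using tendsto_diff[OF lim_v[OF t] lim_v[of 0]] T_pos by (simp add: integral_unique[OF pt(1)[OF t]])
    ultimately show ?thesis using LIMSEQ_unique by (metis has_integral_iff)
  qed
  moreover have "((\<lambda>s. force s (v s)) has_integral y 0 - y t) {0..t}" if t: "t \<in> {0..T}" for t
  proof -
    have "(\<lambda>s. force s (v s)) integrable_on {0..t}"
      by (intro force_integrable continuous_on_subset[OF cont(1)]) (use t in auto)
    moreover have "(\<lambda>j. integral {0..t} (\<lambda>s. force s (us (k j) s))) \<longlonglongrightarrow> integral {0..t} (\<lambda>s. force s (v s))"
      by (rule dominated_convergence(2)[where h = "\<lambda>_. K"])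
        (use pt(2)[OF t] K pt(3) t in \<open>auto intro!: force_lim lim_us\<close>)
    moreover have "(\<lambda>j. integral {0..t} (\<lambda>s. force s (us (k j) s))) \<longlonglongrightarrow> y 0 - y t"
      using tendsto_diff[OF lim_y[of 0] lim_y[OF t]] T_pos by (simp add: integral_unique[OF pt(2)[OF t]])
    ultimately show ?thesis using LIMSEQ_unique by (metis has_integral_iff)
  qed
  ultimately have "trajectory v y" using cont unfolding trajectory_def by blast
  moreover have "((v 0, y 0), (v T, y T)) \<in> P"
  proof (rule closed_sequentially[OF P])
    show "((u (k j) 0, w (k j) 0), (u (k j) T, w (k j) T)) \<in> P" for j
      using nz(3)[of "k j"] by (simp add: ends)
    show "(\<lambda>j. ((u (k j) 0, w (k j) 0), (u (k j) T, w (k j) T))) \<longlonglongrightarrow> ((v 0, y 0), (v T, y T))"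
      using T_pos by (intro tendsto_Pair lim_v lim_y) auto
  qed
  ultimately show thesis by (rule that)
qed

end

section \<open>Qualitative behaviour of trajectories\<close>

text \<open>Used to follow the sign of the slope variable up to the first moment at which it could change.\<close>

lemma first_zero:
  fixes f :: "real \<Rightarrow> real"
  assumes f: "continuous_on {s..t} f" and st: "s \<le> t" "f s < 0" "0 \<le> f t"
  obtains r where "s < r" "r \<le> t" "f r = 0" "\<And>x. s \<le> x \<Longrightarrow> x < r \<Longrightarrow> f x < 0"
proof -
  let ?Z = "{x \<in> {s..t}. f x = 0}"
  have "closed ?Z" by (intro continuous_closed_preimage_constant f) simp
  moreover have "bounded ?Z" by (rule bounded_subset[OF bounded_closed_interval[of s t]]) auto
  ultimately have "compact ?Z" by (simp add: compact_eq_bounded_closed)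
  moreover have "?Z \<noteq> {}"
  proof -
    have "\<exists>x\<ge>s. x \<le> t \<and> f x = 0" by (rule IVT') (use st f in auto)
    then show ?thesis by auto
  qed
  ultimately have "\<exists>r\<in>?Z. \<forall>x\<in>?Z. r \<le> x" by (rule compact_attains_inf)
  then obtain r where r: "r \<in> ?Z" "\<forall>x\<in>?Z. r \<le> x" by (elim bexE)
  from r(1) have r1: "s \<le> r" "r \<le> t" "f r = 0" by simp_all
  have "s \<noteq> r" using r1(3) st(2) by force
  with r1 have "s < r" by simp
  moreover have "f x < 0" if x: "s \<le> x" "x < r" for x
  proof (rule ccontr)
    assume "\<not> f x < 0"
    then have "0 \<le> f x" by simp
    have "\<exists>y\<ge>s. y \<le> x \<and> f y = 0"
      by (rule IVT'[OF _ \<open>0 \<le> f x\<close> x(1) continuous_on_subset[OF f]]) (use st x r1 in auto)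
    then obtain y where "s \<le> y" "y \<le> x" "f y = 0" by blast
    then have "y \<in> ?Z" using x r1 by simp
    then show False using r(2) x \<open>y \<le> x\<close> by (meson not_le order_trans)
  qed
  ultimately show thesis using r1 that by blast
qed

context mink_system
begin

text \<open>Kinetic energy \<open>sqrt (1 + w\<^sup>2)\<close> minus \<open>N\<close> times the primitive of \<open>g\<close>, as a function of the point
\<open>(x, y) = (u, w)\<close>. For \<open>N\<close> a bound of the negative part of the weight it is monotone along pieces of
trajectories on which \<open>w\<close> has a constant sign.\<close>

definition energy :: "real \<Rightarrow> real \<Rightarrow> real \<Rightarrow> real" where
  "energy N x y = sqrt (1 + y\<^sup>2) - N * integral {0..x} g"

context
  fixes u w :: "real \<Rightarrow> real"
  assumes traj: "trajectory u w"
begin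

lemma traj_continuous: "continuous_on {0..T} u" "continuous_on {0..T} w"
  using traj by (auto simp: trajectory_def)

lemma traj_slope_has_integral:
  assumes "0 \<le> s" "s \<le> t" "t \<le> T"
  shows "((\<lambda>r. mink_slope (w r)) has_integral u t - u s) {s..t}"
proof -
  have i: "((\<lambda>s. mink_slope (w s)) has_integral u t - u 0) {0..t}" "((\<lambda>s. mink_slope (w s)) has_integral u s - u 0) {0..s}"
    using traj assms by (auto simp: trajectory_def)
  have "integral {0..s} (\<lambda>s. mink_slope (w s)) + integral {s..t} (\<lambda>s. mink_slope (w s)) = integral {0..t} (\<lambda>s. mink_slope (w s))"
    by (rule Henstock_Kurzweil_Integration.integral_combine) (use assms i in auto)
  moreover have "(\<lambda>s. mink_slope (w s)) integrable_on {s..t}"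
    by (rule integrable_on_subinterval[OF has_integral_integrable[OF i(1)]]) (use assms in auto)
  ultimately show ?thesis using i by (simp add: has_integral_iff)
qed

lemma traj_force_has_integral:
  assumes "0 \<le> s" "s \<le> t" "t \<le> T"
  shows "((\<lambda>r. force r (u r)) has_integral w s - w t) {s..t}"
proof -
  have i: "((\<lambda>s. force s (u s)) has_integral w 0 - w t) {0..t}" "((\<lambda>s. force s (u s)) has_integral w 0 - w s) {0..s}"
    using traj assms by (auto simp: trajectory_def)
  have "integral {0..s} (\<lambda>s. force s (u s)) + integral {s..t} (\<lambda>s. force s (u s)) = integral {0..t} (\<lambda>s. force s (u s))"
    by (rule Henstock_Kurzweil_Integration.integral_combine) (use assms i in auto)
  moreover have "(\<lambda>s. force s (u s)) integrable_on {s..t}"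
    by (rule integrable_on_subinterval[OF has_integral_integrable[OF i(1)]]) (use assms in auto)
  ultimately show ?thesis using i by (simp add: has_integral_iff)
qed

lemma traj_u_derivative:
  assumes t: "t \<in> {0..T}"
  shows "(u has_real_derivative mink_slope (w t)) (at t within {0..T})"
proof -
  have "continuous_on {0..T} (\<lambda>r. mink_slope (w r))" by (intro continuous_intros traj_continuous)
  from integral_has_real_derivative[OF this t]
  have "((\<lambda>r. u 0 + integral {0..r} (\<lambda>r. mink_slope (w r))) has_real_derivative mink_slope (w t)) (at t within {0..T})"
    by (auto intro!: derivative_eq_intros)
  then show ?thesis
  proof (rule has_field_derivative_transform_within[OF _ zero_less_one t])
    fix r assume "r \<in> {0..T}"
    then show "u 0 + integral {0..r} (\<lambda>r. mink_slope (w r)) = u r"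
      using integral_unique[OF traj_slope_has_integral[of 0 r]] by simp
  qed
qed

lemma traj_u_lipschitz:
  assumes "s \<in> {0..T}" "t \<in> {0..T}"
  shows "\<bar>u t - u s\<bar> \<le> \<bar>t - s\<bar>"
proof -
  have *: "\<bar>u t - u s\<bar> \<le> 1 * (t - s)" if "0 \<le> s" "s \<le> t" "t \<le> T" for s t
    by (rule has_integral_abs_bound[OF traj_slope_has_integral])
      (use that abs_mink_slope_less_1 in \<open>auto intro: less_imp_le\<close>)
  show ?thesis using *[of s t] *[of t s] assms by (cases "s \<le> t") auto
qed

lemma traj_u_antimono:
  assumes "0 \<le> s" "s \<le> t" "t \<le> T" "\<And>r. r \<in> {s..t} \<Longrightarrow> w r \<le> 0"
  shows "u t \<le> u s"
proof -
  have "((\<lambda>r. - mink_slope (w r)) has_integral - (u t - u s)) {s..t}"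
    by (rule has_integral_neg[OF traj_slope_has_integral]) (use assms in auto)
  then have "0 \<le> - (u t - u s)"
    by (rule has_integral_nonneg) (use assms in \<open>auto simp: mink_slope_sgn\<close>)
  then show ?thesis by simp
qed

lemma traj_u_mono:
  assumes "0 \<le> s" "s \<le> t" "t \<le> T" "\<And>r. r \<in> {s..t} \<Longrightarrow> 0 \<le> w r"
  shows "u s \<le> u t"
proof -
  have "0 \<le> u t - u s"
    by (rule has_integral_nonneg[OF traj_slope_has_integral])
      (use assms in \<open>auto simp: mink_slope_sgn\<close>)
  then show ?thesis by simp
qed

lemma traj_u_strict:
  assumes st: "0 \<le> s" "s < t" "t \<le> T"
  shows "(\<And>r. s < r \<Longrightarrow> r < t \<Longrightarrow> w r < 0) \<Longrightarrow> u t < u s"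
    and "(\<And>r. s < r \<Longrightarrow> r < t \<Longrightarrow> 0 < w r) \<Longrightarrow> u s < u t"
proof -
  have d: "(u has_real_derivative mink_slope (w r)) (at r)" if "s < r" "r < t" for r
    using traj_u_derivative[of r] at_within_Icc_at[of 0 r T] that st by auto
  have c: "continuous_on {s..t} u"
    by (rule continuous_on_subset[OF traj_continuous(1)]) (use st in auto)
  show "u t < u s" if "\<And>r. s < r \<Longrightarrow> r < t \<Longrightarrow> w r < 0"
  proof (rule DERIV_neg_imp_decreasing_open[OF st(2) _ c])
    fix r assume "s < r" "r < t"
    then show "\<exists>y. (u has_real_derivative y) (at r) \<and> y < 0"
      using d[of r] that[of r] by (auto simp: mink_slope_sgn intro!: exI[of _ "mink_slope (w r)"])
  qed
  show "u s < u t" if "\<And>r. s < r \<Longrightarrow> r < t \<Longrightarrow> 0 < w r"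
  proof (rule DERIV_pos_imp_increasing_open[OF st(2) _ c])
    fix r assume "s < r" "r < t"
    then show "\<exists>y. (u has_real_derivative y) (at r) \<and> 0 < y"
      using d[of r] that[of r] by (auto simp: mink_slope_sgn intro!: exI[of _ "mink_slope (w r)"])
  qed
qed

lemma traj_w_decreasing_of_neg:
  assumes st: "0 \<le> s" "s < t" "t \<le> T" and neg: "\<And>r. s \<le> r \<Longrightarrow> r \<le> t \<Longrightarrow> u r < 0"
  shows "w t < w s"
proof -
  have "((\<lambda>r. force r (u r)) has_integral w s - w t) {s..t}"
    using traj_force_has_integral[of s t] st by simp
  then have i: "((\<lambda>r. gneg (u r)) has_integral w s - w t) {s..t}"
    by (rule has_integral_eq[rotated]) (use neg in \<open>auto simp: force_def gpos_simps less_imp_le\<close>)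
  have "integral {s..t} (\<lambda>r. 0) < integral {s..t} (\<lambda>r. gneg (u r))"
  proof (rule integral_less_real)
    show "continuous_on {s..t} (\<lambda>r. gneg (u r))"
      by (intro continuous_intros continuous_on_subset[OF traj_continuous(1)]) (use st in auto)
    show "0 < gneg (u r)" if "r \<in> {s<..<t}" for r
      using neg[of r] that g_pos[of "- u r"] by (auto simp: gneg_simps)
  qed (use st in auto)
  then show ?thesis using i by (simp add: integral_unique)
qed

text \<open>The maximum principle. At a negative minimum \<open>p\<close> of \<open>u\<close> the strict decrease of \<open>w\<close> near \<open>p\<close> implies
\<open>0 < w p\<close> if \<open>p < T\<close> (otherwise \<open>u\<close> decreases further to the right) and \<open>w p < 0\<close> if \<open>0 < p\<close>. So the
minimum is at an end point, and there the boundary conditions exclude it. The condition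
\<open>w 0 \<le> w T\<close> also covers the points where the shooting map points in the direction \<open>(0, 1)\<close>.\<close>

lemma traj_nonneg:
  assumes w: "w 0 \<le> w T" and bc: "u T = u 0 \<or> w 0 = 0" and t: "t \<in> {0..T}"
  shows "0 \<le> u t"
proof (rule ccontr)
  assume "\<not> 0 \<le> u t"
  obtain t1 where t1: "t1 \<in> {0..T}" "\<And>t. t \<in> {0..T} \<Longrightarrow> u t1 \<le> u t"
    using continuous_attains_inf[OF compact_Icc _ traj_continuous(1)] T_pos by auto
  have neg: "u t1 < 0" using t1(2)[OF t] \<open>\<not> 0 \<le> u t\<close> by simp
  have near: "\<exists>d>0. \<forall>r\<in>{0..T}. \<bar>r - p\<bar> < d \<longrightarrow> u r < 0" if p: "p \<in> {0..T}" "u p < 0" for p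
  proof -
    have "0 < - u p" using p by simp
    then obtain d where "0 < d" "\<And>r. r \<in> {0..T} \<Longrightarrow> \<bar>r - p\<bar> < d \<Longrightarrow> \<bar>u r - u p\<bar> < - u p"
      using traj_continuous(1) p unfolding continuous_on_iff dist_real_def by blast
    then show ?thesis by (intro exI[of _ d]) fastforce
  qed
  have right: "0 < w p" if p: "p \<in> {0..T}" "u p = u t1" "p < T" for p
  proof (rule ccontr)
    assume "\<not> 0 < w p"
    obtain d where d: "0 < d" "\<And>r. r \<in> {0..T} \<Longrightarrow> \<bar>r - p\<bar> < d \<Longrightarrow> u r < 0"
      using near[of p] p neg by auto
    define q where "q = min T (p + d / 2)"
    have q: "p < q" "q \<le> T" "q \<le> p + d / 2" using p d by (auto simp: q_def)
    have "w r < 0" if "p < r" "r < q" for r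
    proof -
      have "w r < w p" by (rule traj_w_decreasing_of_neg) (use that p q d in auto)
      then show ?thesis using \<open>\<not> 0 < w p\<close> by simp
    qed
    then have "u q < u p" using p q by (intro traj_u_strict(1)) auto
    then show False using t1(2)[of q] p q by auto
  qed
  have left: "w p < 0" if p: "p \<in> {0..T}" "u p = u t1" "0 < p" for p
  proof (rule ccontr)
    assume "\<not> w p < 0"
    obtain d where d: "0 < d" "\<And>r. r \<in> {0..T} \<Longrightarrow> \<bar>r - p\<bar> < d \<Longrightarrow> u r < 0"
      using near[of p] p neg by auto
    define q where "q = max 0 (p - d / 2)"
    have q: "q < p" "0 \<le> q" "p - d / 2 \<le> q" using p d by (auto simp: q_def)
    have "0 < w r" if "q < r" "r < p" for r
    proof -
      have "w p < w r" by (rule traj_w_decreasing_of_neg) (use that p q d in auto)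
      then show ?thesis using \<open>\<not> w p < 0\<close> by simp
    qed
    then have "u q < u p" using p q by (intro traj_u_strict(2)) auto
    then show False using t1(2)[of q] p q by auto
  qed
  have ends: "0 \<in> {0..T}" "T \<in> {0..T}" using T_pos by auto
  have "0 < w t1" if "t1 < T" using right[OF t1(1) refl that] .
  moreover have "w t1 < 0" if "0 < t1" using left[OF t1(1) refl that] .
  ultimately consider "t1 = 0" "0 < w 0" | "t1 = T" "w T < 0"
    using t1(1) T_pos by (cases "t1 = 0"; cases "t1 = T") auto
  then show False
  proof cases
    case 1
    then have "u T = u t1" using bc by simp
    then have "w T < 0" by (rule left[OF ends(2) _ T_pos])
    with 1 w show False by simp
  next
    case 2
    then have "u 0 = u t1" using bc w by auto
    then have "0 < w 0" by (rule right[OF ends(1) _ T_pos])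
    with 2 w show False by simp
  qed
qed

text \<open>The origin is an equilibrium near which the system is linearly bounded: since \<open>g x \<le> \<kappa> x\<close>, the
function \<open>\<bar>u\<bar> + \<bar>w\<bar>\<close> satisfies a Gronwall inequality. In particular a trajectory that passes through
the origin is constantly \<open>0\<close>, although uniqueness may fail elsewhere.\<close>

lemma traj_gronwall:
  assumes R: "\<And>t. t \<in> {0..T} \<Longrightarrow> \<bar>u t\<bar> \<le> R" and \<kappa>: "0 \<le> \<kappa>" "\<And>x. 0 \<le> x \<Longrightarrow> x \<le> R \<Longrightarrow> g x \<le> \<kappa> * x"
    and st: "s \<in> {0..T}" "t \<in> {0..T}"
  shows "\<bar>u t\<bar> + \<bar>w t\<bar> \<le> exp ((1 + max C 1 * \<kappa>) * T) * (\<bar>u s\<bar> + \<bar>w s\<bar>)"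
proof (rule gronwall_two_sided[where y = "\<lambda>t. \<bar>u t\<bar> + \<bar>w t\<bar>", OF _ _ _ _ st])
  let ?m = "\<lambda>t. \<bar>u t\<bar> + \<bar>w t\<bar>"
  show cm: "continuous_on {0..T} ?m" by (intro continuous_intros traj_continuous)
  show L0: "0 \<le> 1 + max C 1 * \<kappa>" using \<kappa> by simp
  fix s t assume st: "0 \<le> s" "s \<le> t" "t \<le> T"
  have cu: "continuous_on {s..t} u" and cw: "continuous_on {s..t} w"
    by (rule continuous_on_subset[OF traj_continuous(1)] continuous_on_subset[OF traj_continuous(2)], use st in auto)+
  have iw: "(\<lambda>r. \<bar>w r\<bar>) integrable_on {s..t}" and iu: "(\<lambda>r. max C 1 * \<kappa> * \<bar>u r\<bar>) integrable_on {s..t}"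
    and im: "?m integrable_on {s..t}"
    by (intro integrable_continuous_real continuous_intros cu cw)+
  have "\<bar>u t - u s\<bar> \<le> integral {s..t} (\<lambda>r. \<bar>w r\<bar>)"
    using integral_norm_bound_integral[OF has_integral_integrable[OF traj_slope_has_integral[OF st]] iw]
      abs_mink_slope_le by (simp add: integral_unique[OF traj_slope_has_integral[OF st]])
  moreover have "\<bar>w s - w t\<bar> \<le> integral {s..t} (\<lambda>r. max C 1 * \<kappa> * \<bar>u r\<bar>)"
  proof -
    have "norm (force r (u r)) \<le> max C 1 * \<kappa> * \<bar>u r\<bar>" if r: "r \<in> {s..t}" for r
    proof -
      have r': "r \<in> {0..T}" using r st by auto
      have "max C 1 * g \<bar>u r\<bar> \<le> max C 1 * (\<kappa> * \<bar>u r\<bar>)"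
        using \<kappa>(2)[of "\<bar>u r\<bar>"] R[OF r'] by (intro mult_left_mono) auto
      then show ?thesis using abs_force_le[OF r', of "u r"] by (simp add: mult.assoc)
    qed
    from integral_norm_bound_integral[OF has_integral_integrable[OF traj_force_has_integral[OF st]] iu this]
    show ?thesis by (simp add: integral_unique[OF traj_force_has_integral[OF st]])
  qed
  ultimately have "\<bar>?m t - ?m s\<bar> \<le> integral {s..t} (\<lambda>r. \<bar>w r\<bar> + max C 1 * \<kappa> * \<bar>u r\<bar>)"
    using Henstock_Kurzweil_Integration.integral_add[OF iw iu] by linarith
  also have "\<dots> \<le> integral {s..t} (\<lambda>r. (1 + max C 1 * \<kappa>) * ?m r)"
  proof (rule integral_le)
    show "\<bar>w r\<bar> + max C 1 * \<kappa> * \<bar>u r\<bar> \<le> (1 + max C 1 * \<kappa>) * ?m r" for r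
    proof -
      have "0 \<le> max C 1 * \<kappa> * \<bar>w r\<bar>" using \<kappa> by simp
      then show ?thesis by (simp add: algebra_simps)
    qed
  qed (intro integrable_continuous_real continuous_intros cu cw)+
  finally show "\<bar>?m t - ?m s\<bar> \<le> (1 + max C 1 * \<kappa>) * integral {s..t} ?m" by simp
qed simp

lemma traj_energy_has_integral:
  assumes nonneg: "\<And>t. t \<in> {0..T} \<Longrightarrow> 0 \<le> u t" and st: "0 \<le> s" "s \<le> t" "t \<le> T"
  shows "((\<lambda>r. - mink_slope (w r) * ((a r + N) * g (u r))) has_integral
           energy N (u t) (w t) - energy N (u s) (w s)) {s..t}"
proof -
  have R: "\<bar>u t\<bar> \<le> \<bar>u 0\<bar> + T" if "t \<in> {0..T}" for t
    using traj_u_lipschitz[of 0 t] that T_pos by auto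
  obtain K where K: "0 \<le> K"
    "\<And>t x. t \<in> {0..T} \<Longrightarrow> \<bar>x\<bar> \<le> \<bar>u 0\<bar> + T \<Longrightarrow> \<bar>force t x\<bar> \<le> K"
    using force_bound[where R = "\<bar>u 0\<bar> + T"] by blast
  have "((\<lambda>r. mink_slope (w r) * (- force r (u r))) has_integral sqrt (1 + (w t)\<^sup>2) - sqrt (1 + (w s)\<^sup>2)) {s..t}"
  proof (rule chain_rule_indefinite_integral[where X = w and x = "\<lambda>r. - force r (u r)" and K = K,
        OF _ _ sqrt_energy_derivative])
    fix p q assume pq: "s \<le> p" "p \<le> q" "q \<le> t"
    have "((\<lambda>r. - force r (u r)) has_integral - (w p - w q)) {p..q}"
      by (rule has_integral_neg[OF traj_force_has_integral]) (use pq st in auto)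
    then show "((\<lambda>r. - force r (u r)) has_integral w q - w p) {p..q}" by simp
  qed (use st K R in \<open>auto intro: continuous_intros\<close>)
  moreover have "((\<lambda>r. g (u r) * mink_slope (w r)) has_integral integral {0..u t} g - integral {0..u s} g) {s..t}"
  proof (rule fundamental_theorem_of_calculus[OF st(2)])
    fix r assume r: "r \<in> {s..t}"
    have uR: "u ` {s..t} \<subseteq> {0..\<bar>u 0\<bar> + T}" using nonneg R st by force
    have "continuous_on {0..\<bar>u 0\<bar> + T} g" by (rule continuous_on_subset[OF g_cont]) auto
    then have "((\<lambda>x. integral {0..x} g) has_real_derivative g (u r)) (at (u r) within {0..\<bar>u 0\<bar> + T})"
      by (rule integral_has_real_derivative) (use uR r in blast)
    then have 1: "((\<lambda>x. integral {0..x} g) has_real_derivative g (u r)) (at (u r) within u ` {s..t})"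
      by (rule DERIV_subset) (rule uR)
    have "(u has_real_derivative mink_slope (w r)) (at r within {s..t})"
      by (rule DERIV_subset[OF traj_u_derivative]) (use r st in auto)
    from DERIV_image_chain[OF 1 this]
    show "((\<lambda>x. integral {0..u x} g) has_vector_derivative g (u r) * mink_slope (w r)) (at r within {s..t})"
      by (simp add: has_real_derivative_iff_has_vector_derivative o_def)
  qed
  ultimately have "((\<lambda>r. mink_slope (w r) * (- force r (u r)) - N * (g (u r) * mink_slope (w r))) has_integral
      (sqrt (1 + (w t)\<^sup>2) - sqrt (1 + (w s)\<^sup>2)) - N * (integral {0..u t} g - integral {0..u s} g)) {s..t}"
    by (intro has_integral_diff has_integral_mult_right)
  then have "((\<lambda>r. mink_slope (w r) * (- force r (u r)) - N * (g (u r) * mink_slope (w r))) has_integral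
      energy N (u t) (w t) - energy N (u s) (w s)) {s..t}"
    by (simp add: energy_def algebra_simps)
  then show ?thesis
  proof (rule has_integral_eq[rotated])
    fix r assume "r \<in> {s..t}"
    then have "0 \<le> u r" using nonneg st by auto
    then show "mink_slope (w r) * (- force r (u r)) - N * (g (u r) * mink_slope (w r))
        = - mink_slope (w r) * ((a r + N) * g (u r))"
      by (simp add: force_def gpos_simps gneg_simps algebra_simps)
  qed
qed

context
  fixes N :: real
  assumes nonneg: "\<And>t. t \<in> {0..T} \<Longrightarrow> 0 \<le> u t"
    and N: "0 \<le> N" "\<And>t. t \<in> {0..T} \<Longrightarrow> - N \<le> a t"
begin

text \<open>The derivative of the energy is \<open>- mink_slope w * (a + N) * g(u)\<close>, whose second factor is nonnegative.\<close>

lemma energy_mono_of_neg: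
  assumes st: "0 \<le> s" "s \<le> t" "t \<le> T" and w: "\<And>r. r \<in> {s..t} \<Longrightarrow> w r \<le> 0"
  shows "energy N (u s) (w s) \<le> energy N (u t) (w t)"
proof -
  have "0 \<le> energy N (u t) (w t) - energy N (u s) (w s)"
  proof (rule has_integral_nonneg[OF traj_energy_has_integral[OF nonneg st]])
    fix r assume r: "r \<in> {s..t}"
    then have "r \<in> {0..T}" using st by auto
    then have "0 \<le> (a r + N) * g (u r)" "mink_slope (w r) \<le> 0"
      using N(2)[of r] nonneg[of r] w[OF r] g_nonneg[of "u r"] by (auto simp: mink_slope_sgn)
    then show "0 \<le> - mink_slope (w r) * ((a r + N) * g (u r))"
      by (simp add: mult_le_0_iff)
  qed auto
  then show ?thesis by simp
qed

lemma energy_antimono_of_pos: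
  assumes st: "0 \<le> s" "s \<le> t" "t \<le> T" and w: "\<And>r. r \<in> {s..t} \<Longrightarrow> 0 \<le> w r"
  shows "energy N (u t) (w t) \<le> energy N (u s) (w s)"
proof -
  have "0 \<le> - (energy N (u t) (w t) - energy N (u s) (w s))"
  proof (rule has_integral_nonneg[OF has_integral_neg[OF traj_energy_has_integral[OF nonneg st]]])
    fix r assume r: "r \<in> {s..t}"
    then have "r \<in> {0..T}" using st by auto
    then have "0 \<le> (a r + N) * g (u r)" "0 \<le> mink_slope (w r)"
      using N(2)[of r] nonneg[of r] w[OF r] g_nonneg[of "u r"] by (auto simp: mink_slope_sgn)
    then show "0 \<le> - (- mink_slope (w r) * ((a r + N) * g (u r)))"
      by (simp add: zero_le_mult_iff)
  qed auto
  then show ?thesis by simp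
qed

lemma energy_zero_le_1: "0 \<le> x \<Longrightarrow> energy N x 0 \<le> 1"
proof -
  have "0 \<le> integral {0..x} g"
    by (intro integral_nonneg integrable_continuous_real continuous_on_subset[OF g_cont])
      (auto intro: g_nonneg)
  then show ?thesis using N(1) by (simp add: energy_def)
qed

text \<open>Once \<open>w\<close> is negative with energy above \<open>1\<close> it stays negative: the energy cannot decrease as long as
\<open>w \<le> 0\<close>, but it is at most \<open>1\<close> when \<open>w = 0\<close>.\<close>

lemma negative_slope_persists:
  assumes s: "s \<in> {0..T}" "w s < 0" "1 < energy N (u s) (w s)" and t: "s \<le> t" "t \<le> T"
  shows "w t < 0" "energy N (u s) (w s) \<le> energy N (u t) (w t)"
proof -
  have neg: "w t < 0" if t: "s \<le> t" "t \<le> T" for t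
  proof (rule ccontr)
    assume "\<not> w t < 0"
    have "continuous_on {s..t} w" by (rule continuous_on_subset[OF traj_continuous(2)]) (use s t in auto)
    then obtain r where r: "s < r" "r \<le> t" "w r = 0" "\<And>x. s \<le> x \<Longrightarrow> x < r \<Longrightarrow> w x < 0"
      by (rule first_zero) (use t s(2) \<open>\<not> w t < 0\<close> in auto)
    have "energy N (u s) (w s) \<le> energy N (u r) (w r)"
    proof (rule energy_mono_of_neg)
      show "w x \<le> 0" if "x \<in> {s..r}" for x using r(3) r(4)[of x] that by (cases "x = r") auto
    qed (use s r t in auto)
    then show False using energy_zero_le_1[of "u r"] nonneg[of r] r s t by auto
  qed
  show "w t < 0" by (rule neg[OF t])
  show "energy N (u s) (w s) \<le> energy N (u t) (w t)"
    by (rule energy_mono_of_neg) (use neg s t in \<open>auto intro: less_imp_le\<close>)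
qed

lemma positive_slope_persists_backwards:
  assumes s: "s \<in> {0..T}" "0 < w s" "1 < energy N (u s) (w s)" and t: "0 \<le> t" "t \<le> s"
  shows "0 < w t" "energy N (u s) (w s) \<le> energy N (u t) (w t)"
proof -
  have pos: "0 < w t" if t: "0 \<le> t" "t \<le> s" for t
  proof (rule ccontr)
    assume "\<not> 0 < w t"
    have "continuous_on {- s..- t} (\<lambda>x. - w (- x))"
      by (intro continuous_intros continuous_on_compose2[OF traj_continuous(2)]) (use s t in auto)
    then obtain r where r: "- s < r" "r \<le> - t" "- w (- r) = 0" "\<And>x. - s \<le> x \<Longrightarrow> x < r \<Longrightarrow> - w (- x) < 0"
      by (rule first_zero) (use t s(2) \<open>\<not> 0 < w t\<close> in auto)
    have "energy N (u s) (w s) \<le> energy N (u (- r)) (w (- r))"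
    proof (rule energy_antimono_of_pos)
      show "0 \<le> w x" if "x \<in> {- r..s}" for x using r(3) r(4)[of "- x"] that by (cases "x = - r") auto
    qed (use s r t in auto)
    then show False using energy_zero_le_1[of "u (- r)"] nonneg[of "- r"] r s t by auto
  qed
  show "0 < w t" by (rule pos[OF t])
  show "energy N (u s) (w s) \<le> energy N (u t) (w t)"
    by (rule energy_antimono_of_pos) (use pos s t in \<open>auto intro: less_imp_le\<close>)
qed

text \<open>An energy above \<open>1\<close> at one time makes \<open>w\<close> negative until \<open>T\<close>, or positive from \<open>0\<close> on. This
contradicts \<open>w 0 = 0 \<le> w T\<close>. If \<open>u T = u 0\<close>, then comparison of the energies at \<open>0\<close> and \<open>T\<close> carries
the sign over to the other end, so \<open>w\<close> keeps it on the whole interval and \<open>u\<close> is strictly monotone.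
Hence solutions satisfy the pointwise bound \<open>\<bar>w\<bar> \<le> 1 + N G(u)\<close>, with \<open>G\<close> the primitive of
\<open>g\<close>.\<close>

lemma energy_le_1:
  assumes w: "w 0 \<le> w T" and bc: "u T = u 0 \<or> w 0 = 0" and t: "t \<in> {0..T}"
  shows "energy N (u t) (w t) \<le> 1"
proof (rule ccontr)
  assume "\<not> energy N (u t) (w t) \<le> 1"
  then have E: "1 < energy N (u t) (w t)" by simp
  \<comment> \<open>at a fixed \<open>u\<close> the energy grows with \<open>\<bar>w\<bar>\<close>\<close>
  have mono: "energy N (u 0) y \<le> energy N (u 0) x" if "\<bar>y\<bar> \<le> \<bar>x\<bar>" for x y
    using that by (simp add: energy_def abs_le_square_iff)
  consider "w t < 0" | "w t = 0" | "0 < w t" by linarith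
  then show False
  proof cases
    case 1
    note T = negative_slope_persists[OF t 1 E, of T]
    have T': "w T < 0" "1 < energy N (u T) (w T)" using T E t by auto
    then have "u T = u 0" "w 0 < 0" using w bc by auto
    moreover from this have "1 < energy N (u 0) (w 0)" using T' w mono[of "w T" "w 0"] by auto
    ultimately have "w r < 0" if "r \<in> {0..T}" for r
      using negative_slope_persists(1)[of 0 r] that by auto
    then have "u T < u 0" using T_pos by (intro traj_u_strict(1)) auto
    with \<open>u T = u 0\<close> show False by simp
  next
    case 2
    then show False using E energy_zero_le_1[of "u t"] nonneg[OF t] by simp
  next
    case 3
    note T = positive_slope_persists_backwards[OF t 3 E, of 0]
    have T': "0 < w 0" "1 < energy N (u 0) (w 0)" using T E t by auto
    then have "u T = u 0" "0 < w T" using w bc by auto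
    moreover from this have "1 < energy N (u T) (w T)" using T' w mono[of "w 0" "w T"] by auto
    ultimately have "0 < w r" if "r \<in> {0..T}" for r
      using positive_slope_persists_backwards(1)[of T r] that by auto
    then have "u 0 < u T" using T_pos by (intro traj_u_strict(2)) auto
    with \<open>u T = u 0\<close> show False by simp
  qed
qed

end

end

end

section \<open>Positivity and a priori estimates\<close>

context mink_system
begin

lemma sublinear_near_0:
  assumes lim: "((\<lambda>x. g x / x) \<longlongrightarrow> 0) (at_right 0)" and \<epsilon>: "0 < \<epsilon>"
  obtains \<eta> where "0 < \<eta>" "\<And>x. 0 \<le> x \<Longrightarrow> x < \<eta> \<Longrightarrow> g x \<le> \<epsilon> * x"
proof -
  have "\<forall>\<^sub>F x in at_right 0. g x / x < \<epsilon>" using order_tendstoD(2)[OF lim \<epsilon>] .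
  then obtain \<eta> where \<eta>: "0 < \<eta>" "\<forall>x>0. x < \<eta> \<longrightarrow> g x / x < \<epsilon>"
    unfolding eventually_at_right_field by blast
  have "g x \<le> \<epsilon> * x" if "0 \<le> x" "x < \<eta>" for x
  proof (cases "x = 0")
    case False
    then have "g x / x < \<epsilon>" using \<eta>(2) that by simp
    then show ?thesis using False that by (simp add: pos_divide_less_eq)
  qed (simp add: g_zero)
  with \<eta>(1) show thesis using that by blast
qed

lemma linear_bound_of_sublinear:
  assumes lim: "((\<lambda>x. g x / x) \<longlongrightarrow> 0) (at_right 0)"
  obtains \<kappa> where "0 \<le> \<kappa>" "\<And>x. 0 \<le> x \<Longrightarrow> x \<le> R \<Longrightarrow> g x \<le> \<kappa> * x"
proof -
  obtain \<eta> where \<eta>: "0 < \<eta>" "\<And>x. 0 \<le> x \<Longrightarrow> x < \<eta> \<Longrightarrow> g x \<le> 1 * x"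
    using sublinear_near_0[OF lim zero_less_one] by blast
  have "bounded (g ` {0..R})"
    by (intro compact_imp_bounded compact_continuous_image continuous_on_subset[OF g_cont]) auto
  then obtain M where "\<forall>y\<in>g ` {0..R}. norm y \<le> M" unfolding bounded_iff by blast
  then have M: "g x \<le> max M 0" if "0 \<le> x" "x \<le> R" for x
  proof -
    have "norm (g x) \<le> M" using \<open>\<forall>y\<in>g ` {0..R}. norm y \<le> M\<close> that by auto
    then show ?thesis by simp
  qed
  show thesis
  proof (rule that[of "1 + max M 0 / \<eta>"])
    have c: "0 \<le> max M 0 / \<eta>" using \<eta>(1) by simp
    then show "0 \<le> 1 + max M 0 / \<eta>" by simp
    fix x :: real assume x: "0 \<le> x" "x \<le> R"
    show "g x \<le> (1 + max M 0 / \<eta>) * x"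
    proof (cases "x < \<eta>")
      case True
      have "0 \<le> max M 0 / \<eta> * x" by (rule mult_nonneg_nonneg[OF c x(1)])
      then show ?thesis using \<eta>(2)[OF x(1) True] by (simp add: distrib_right)
    next
      case False
      have "max M 0 * 1 \<le> max M 0 * (x / \<eta>)" using False \<eta>(1) by (intro mult_left_mono) auto
      then have "g x \<le> max M 0 / \<eta> * x" using order_trans[OF M[OF x]] by simp
      then show ?thesis unfolding distrib_right using x(1) by linarith
    qed
  qed
qed

text \<open>A zero \<open>t\<close> of a nonnegative \<open>u\<close> is a minimum, so \<open>w t = 0\<close>; at the end points this uses the boundary
condition. Then the trajectory passes through the origin and vanishes identically.\<close>

lemma traj_positive:
  assumes traj: "trajectory u w" and lim: "((\<lambda>x. g x / x) \<longlongrightarrow> 0) (at_right 0)"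
    and nonneg: "\<And>t. t \<in> {0..T} \<Longrightarrow> 0 \<le> u t"
    and bc: "u T = u 0 \<and> w T = w 0 \<or> w 0 = 0 \<and> w T = 0"
    and nz: "(u 0, w 0) \<noteq> 0" and t: "t \<in> {0..T}"
  shows "0 < u t"
proof (rule ccontr)
  assume "\<not> 0 < u t"
  then have ut: "u t = 0" using nonneg[OF t] by simp
  note cont = traj_continuous(2)[OF traj]
  have near: "\<exists>d>0. \<forall>r\<in>{0..T}. \<bar>r - p\<bar> < d \<longrightarrow> \<bar>w r - w p\<bar> < \<bar>w p\<bar>" if "p \<in> {0..T}" "w p \<noteq> 0" for p
  proof -
    have "0 < \<bar>w p\<bar>" using that by simp
    then show ?thesis using cont that(1) unfolding continuous_on_iff dist_real_def by blast
  qed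
  have right: "0 \<le> w p" if p: "p \<in> {0..T}" "u p = 0" "p < T" for p
  proof (rule ccontr)
    assume neg: "\<not> 0 \<le> w p"
    obtain d where d: "0 < d" "\<And>r. r \<in> {0..T} \<Longrightarrow> \<bar>r - p\<bar> < d \<Longrightarrow> \<bar>w r - w p\<bar> < \<bar>w p\<bar>"
      using near[of p] p neg by auto
    define q where "q = min T (p + d / 2)"
    have q: "p < q" "q \<le> T" "q \<le> p + d / 2" using p d by (auto simp: q_def)
    have "w r < 0" if "p < r" "r < q" for r
    proof -
      have "\<bar>w r - w p\<bar> < \<bar>w p\<bar>" by (rule d(2)) (use that p q d(1) in auto)
      then show ?thesis using neg by linarith
    qed
    then have "u q < u p" using p q by (intro traj_u_strict(1)[OF traj]) auto
    then show False using nonneg[of q] p q by auto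
  qed
  have left: "w p \<le> 0" if p: "p \<in> {0..T}" "u p = 0" "0 < p" for p
  proof (rule ccontr)
    assume pos: "\<not> w p \<le> 0"
    obtain d where d: "0 < d" "\<And>r. r \<in> {0..T} \<Longrightarrow> \<bar>r - p\<bar> < d \<Longrightarrow> \<bar>w r - w p\<bar> < \<bar>w p\<bar>"
      using near[of p] p pos by auto
    define q where "q = max 0 (p - d / 2)"
    have q: "q < p" "0 \<le> q" "p - d / 2 \<le> q" using p d by (auto simp: q_def)
    have "0 < w r" if "q < r" "r < p" for r
    proof -
      have "\<bar>w r - w p\<bar> < \<bar>w p\<bar>" by (rule d(2)) (use that p q d(1) in auto)
      then show ?thesis using pos by linarith
    qed
    then have "u q < u p" using p q by (intro traj_u_strict(2)[OF traj]) auto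
    then show False using nonneg[of q] p q by auto
  qed
  have ends: "0 \<in> {0..T}" "T \<in> {0..T}" using T_pos by auto
  have wt: "w t = 0"
  proof (cases "0 < t \<and> t < T")
    case True
    then show ?thesis using left[OF t ut] right[OF t ut] by simp
  next
    case False
    then have tt: "t = 0 \<or> t = T" using t by auto
    from bc show ?thesis
    proof
      assume per: "u T = u 0 \<and> w T = w 0"
      then have "u 0 = 0" "u T = 0" using tt ut by auto
      then have "0 \<le> w 0" "w T \<le> 0" using right[OF ends(1)] left[OF ends(2)] T_pos by auto
      then show ?thesis using per tt by auto
    qed (use tt in auto)
  qed
  obtain \<kappa> where \<kappa>: "0 \<le> \<kappa>" "\<And>x. 0 \<le> x \<Longrightarrow> x \<le> \<bar>u 0\<bar> + T \<Longrightarrow> g x \<le> \<kappa> * x"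
    using linear_bound_of_sublinear[OF lim, where R = "\<bar>u 0\<bar> + T"] by blast
  have R: "\<bar>u r\<bar> \<le> \<bar>u 0\<bar> + T" if "r \<in> {0..T}" for r
    using traj_u_lipschitz[OF traj ends(1) that] that by auto
  have "\<bar>u 0\<bar> + \<bar>w 0\<bar> \<le> 0"
    using traj_gronwall[OF traj R \<kappa> t ends(1)] ut wt by simp
  then show False using nz by (auto simp: zero_prod_def)
qed

text \<open>The estimate on the inner circle. The hypotheses on \<open>c\<close> hold, for both boundary conditions, if the
shooting map at a small initial point \<open>(u 0, w 0)\<close> equals \<open>- c\<close> times \<open>(w 0, u 0)\<close>. Since \<open>g(x) = o(x)\<close>, the slope variable \<open>w\<close> is
almost constant, up to a small multiple of the radius. If \<open>w 0\<close> were not small itself, \<open>u\<close> would move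
in the direction of \<open>w 0\<close>, against \<open>- c * w 0\<close>. Hence \<open>w\<close> is small and \<open>u\<close> is nearly constant, with a
small relative error. For \<open>u 0 > 0\<close> the regular oscillation of \<open>g\<close> then gives \<open>w T - w 0\<close> close to
\<open>- g(u 0)\<close> times the mean of the weight, which is positive, against \<open>- c * u 0 \<le> 0\<close>. For \<open>u 0 < 0\<close>
the extended nonlinearity makes \<open>w\<close> decrease, against \<open>- c * u 0 \<ge> 0\<close>.\<close>

lemma no_small_trajectory:
  assumes lim: "((\<lambda>x. g x / x) \<longlongrightarrow> 0) (at_right 0)"
    and reg: "((\<lambda>(x, \<omega>). g (\<omega> * x) / g x) \<longlongrightarrow> 1) (at_right 0 \<times>\<^sub>F at 1)"
    and mean: "integral {0..T} a < 0"
  obtains \<rho> where "0 < \<rho>"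
    "\<And>u w c. trajectory u w \<Longrightarrow> norm (u 0, w 0) < \<rho> \<Longrightarrow> (u 0, w 0) \<noteq> 0 \<Longrightarrow> 0 \<le> c \<Longrightarrow>
      u T - u 0 = - c * w 0 \<or> w 0 = 0 \<Longrightarrow> w T - w 0 = - c * u 0 \<Longrightarrow> False"
proof -
  \<comment> \<open>relative error of \<open>g\<close> for which the integral of the weight stays dominant\<close>
  define \<epsilon>3 where "\<epsilon>3 = - integral {0..T} a / (2 * (C * T + 1))"
  have CT: "0 < C * T + 1" using C_nonneg T_pos by (simp add: add_nonneg_pos)
  have \<epsilon>3: "0 < \<epsilon>3" "integral {0..T} a + C * \<epsilon>3 * T < 0"
  proof -
    show e0: "0 < \<epsilon>3" unfolding \<epsilon>3_def using mean CT by (intro divide_pos_pos) auto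
    have "(C * T + 1) * \<epsilon>3 = - integral {0..T} a / 2" using CT by (simp add: \<epsilon>3_def field_simps)
    then have "C * \<epsilon>3 * T = - integral {0..T} a / 2 - \<epsilon>3" by (simp add: algebra_simps)
    then show "integral {0..T} a + C * \<epsilon>3 * T < 0" using e0 mean by linarith
  qed
  obtain d1 d2 where d: "0 < d1" "0 < d2"
    "\<And>x \<omega>. 0 < x \<Longrightarrow> x < d1 \<Longrightarrow> \<bar>\<omega> - 1\<bar> < d2 \<Longrightarrow> \<bar>g (\<omega> * x) / g x - 1\<bar> < \<epsilon>3"
  proof -
    have "\<forall>\<^sub>F p in at_right 0 \<times>\<^sub>F at 1. dist (case p of (x, \<omega>) \<Rightarrow> g (\<omega> * x) / g x) 1 < \<epsilon>3"
      using tendstoD[OF reg \<epsilon>3(1)] .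
    then obtain P Q where PQ: "eventually P (at_right (0::real))" "eventually Q (at (1::real))"
      "\<And>x \<omega>. P x \<Longrightarrow> Q \<omega> \<Longrightarrow> dist (g (\<omega> * x) / g x) 1 < \<epsilon>3"
      unfolding eventually_prod_filter by auto
    obtain d1 where d1: "0 < d1" "\<forall>x>0. x < d1 \<longrightarrow> P x"
      using PQ(1) unfolding eventually_at_right_field by blast
    obtain d2 where d2: "0 < d2" "\<forall>\<omega>. \<omega> \<noteq> 1 \<and> dist \<omega> 1 < d2 \<longrightarrow> Q \<omega>"
      using PQ(2) unfolding eventually_at by auto
    show thesis
    proof (rule that[OF d1(1) d2(1)])
      fix x \<omega> :: real assume x: "0 < x" "x < d1" "\<bar>\<omega> - 1\<bar> < d2"
      show "\<bar>g (\<omega> * x) / g x - 1\<bar> < \<epsilon>3"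
      proof (cases "\<omega> = 1")
        case True
        then show ?thesis using g_pos[OF x(1)] \<epsilon>3(1) by simp
      next
        case False
        then show ?thesis using PQ(3)[of x \<omega>] d1(2) d2(2) x by (simp add: dist_real_def)
      qed
    qed
  qed
  obtain \<kappa> where \<kappa>: "0 \<le> \<kappa>" "\<And>x. 0 \<le> x \<Longrightarrow> x \<le> 1 + T \<Longrightarrow> g x \<le> \<kappa> * x"
    using linear_bound_of_sublinear[OF lim, where R = "1 + T"] by blast
  define M where "M = 2 * exp ((1 + max C 1 * \<kappa>) * T)"
  have M: "0 < M" by (simp add: M_def)
  \<comment> \<open>bound of the variation of \<open>w\<close>, relative to the radius; the relative variation of \<open>u\<close> is then at most \<open>4 * T * \<epsilon>1\<close>\<close>
  define \<epsilon>1 where "\<epsilon>1 = min (1 / 2) (min d2 1 / (8 * T))"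
  have \<epsilon>1: "0 < \<epsilon>1" "\<epsilon>1 \<le> 1 / 2" "4 * T * \<epsilon>1 \<le> min d2 1 / 2"
  proof -
    show "0 < \<epsilon>1" "\<epsilon>1 \<le> 1 / 2" using d T_pos by (auto simp: \<epsilon>1_def)
    have "4 * T * \<epsilon>1 \<le> 4 * T * (min d2 1 / (8 * T))"
      using T_pos by (intro mult_left_mono) (auto simp: \<epsilon>1_def)
    then show "4 * T * \<epsilon>1 \<le> min d2 1 / 2" using T_pos by simp
  qed
  \<comment> \<open>slope of \<open>g\<close> near \<open>0\<close> for which the force integrates to at most \<open>\<epsilon>1\<close> times the radius\<close>
  define \<epsilon> where "\<epsilon> = \<epsilon>1 / (max C 1 * M * T)"
  have \<epsilon>: "0 < \<epsilon>" "max C 1 * (\<epsilon> * M) * T = \<epsilon>1"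
    using \<epsilon>1 M T_pos by (auto simp: \<epsilon>_def field_simps)
  obtain \<eta> where \<eta>: "0 < \<eta>" "\<And>x. 0 \<le> x \<Longrightarrow> x < \<eta> \<Longrightarrow> g x \<le> \<epsilon> * x"
    using sublinear_near_0[OF lim \<epsilon>(1)] by blast
  define \<rho>0 where "\<rho>0 = min 1 (min (\<eta> / M) d1)"
  have \<rho>0: "0 < \<rho>0" "\<rho>0 \<le> 1" "\<rho>0 \<le> \<eta> / M" "\<rho>0 \<le> d1" using \<eta> M d by (auto simp: \<rho>0_def)
  show thesis
  proof (rule that[OF \<rho>0(1)])
    fix u w c
    assume traj: "trajectory u w" and small: "norm (u 0, w 0) < \<rho>0" and nz: "(u 0, w 0) \<noteq> 0"
      and c: "0 \<le> (c :: real)" and bc1: "u T - u 0 = - c * w 0 \<or> w 0 = 0" and bc2: "w T - w 0 = - c * u 0"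
    define \<rho> where "\<rho> = norm (u 0, w 0)"
    have \<rho>: "0 < \<rho>" "\<rho> < \<rho>0" using small nz by (auto simp: \<rho>_def simp del: norm_Pair)
    have u0: "\<bar>u 0\<bar> \<le> \<rho>" and w0: "\<bar>w 0\<bar> \<le> \<rho>" and sum: "\<rho> \<le> \<bar>u 0\<bar> + \<bar>w 0\<bar>"
      using norm_fst_le[of "u 0" "w 0"] norm_snd_le[of "w 0" "u 0"] norm_Pair_le[of "u 0" "w 0"]
      by (simp_all add: \<rho>_def)
    have z: "0 \<in> {0..T}" using T_pos by simp
    have R: "\<bar>u t\<bar> \<le> 1 + T" if "t \<in> {0..T}" for t
      using traj_u_lipschitz[OF traj z that] that u0 \<rho> \<rho>0 by auto
    have uM: "\<bar>u t\<bar> \<le> M * \<rho>" if t: "t \<in> {0..T}" for t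
    proof -
      have "\<bar>u t\<bar> + \<bar>w t\<bar> \<le> exp ((1 + max C 1 * \<kappa>) * T) * (\<bar>u 0\<bar> + \<bar>w 0\<bar>)"
        by (rule traj_gronwall[OF traj R \<kappa> z t])
      also have "\<dots> \<le> exp ((1 + max C 1 * \<kappa>) * T) * (2 * \<rho>)"
        using u0 w0 by (intro mult_left_mono) auto
      finally show ?thesis by (simp add: M_def)
    qed
    have w_close: "\<bar>w t - w 0\<bar> \<le> \<epsilon>1 * \<rho>" if t: "t \<in> {0..T}" for t
    proof -
      have "\<bar>force r (u r)\<bar> \<le> max C 1 * (\<epsilon> * (M * \<rho>))" if r: "r \<in> {0..t}" for r
      proof -
        have r': "r \<in> {0..T}" using r t by auto
        have "M * \<rho> < M * (\<eta> / M)" using \<rho> \<rho>0 M by (intro mult_strict_left_mono) auto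
        then have "\<bar>u r\<bar> < \<eta>" using uM[OF r'] M by simp
        then have "g \<bar>u r\<bar> \<le> \<epsilon> * \<bar>u r\<bar>" by (intro \<eta>) auto
        also have "\<dots> \<le> \<epsilon> * (M * \<rho>)" using uM[OF r'] \<epsilon> by (intro mult_left_mono) auto
        finally have "max C 1 * g \<bar>u r\<bar> \<le> max C 1 * (\<epsilon> * (M * \<rho>))" by (intro mult_left_mono) auto
        then show ?thesis using abs_force_le[OF r', of "u r"] by simp
      qed
      moreover have "((\<lambda>r. force r (u r)) has_integral w 0 - w t) {0..t}"
        using traj_force_has_integral[OF traj, of 0 t] t by simp
      ultimately have "\<bar>w 0 - w t\<bar> \<le> max C 1 * (\<epsilon> * (M * \<rho>)) * (t - 0)"
        using t by (intro has_integral_abs_bound) auto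
      also have "\<dots> \<le> max C 1 * (\<epsilon> * (M * \<rho>)) * T"
        using t \<epsilon> M \<rho> by (intro mult_left_mono) auto
      also have "\<dots> = \<epsilon>1 * \<rho>" by (simp flip: \<epsilon>(2))
      finally show ?thesis by (simp add: abs_minus_commute)
    qed
    have w0_small: "\<bar>w 0\<bar> \<le> \<epsilon>1 * \<rho>"
    proof (rule ccontr)
      assume big: "\<not> \<bar>w 0\<bar> \<le> \<epsilon>1 * \<rho>"
      then have "w 0 \<noteq> 0" using \<epsilon>1 \<rho> by auto
      then have eq: "u T - u 0 = - c * w 0" using bc1 by simp
      have same: "\<bar>w t - w 0\<bar> < \<bar>w 0\<bar>" if "t \<in> {0..T}" for t using w_close[OF that] big by simp
      show False
      proof (cases "0 < w 0")
        case True
        have "0 < w t" if "0 < t" "t < T" for t using same[of t] that True by auto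
        then have "u 0 < u T" using T_pos by (intro traj_u_strict(2)[OF traj]) auto
        moreover have "0 \<le> c * w 0" using True c by simp
        ultimately show False using eq by simp
      next
        case False
        have "w t < 0" if "0 < t" "t < T" for t using same[of t] that False by auto
        then have "u T < u 0" using T_pos by (intro traj_u_strict(1)[OF traj]) auto
        moreover have "c * w 0 \<le> 0" using False c by (simp add: mult_le_0_iff)
        ultimately show False using eq by simp
      qed
    qed
    have "\<epsilon>1 * \<rho> \<le> \<rho> / 2" using \<epsilon>1(2) \<rho>(1) mult_right_mono[of \<epsilon>1 "1/2" \<rho>] by simp
    then have u0_big: "\<rho> \<le> 2 * \<bar>u 0\<bar>" using sum w0_small by linarith
    have u_close: "\<bar>u t - u 0\<bar> \<le> min d2 1 / 2 * \<bar>u 0\<bar>" if t: "t \<in> {0..T}" for t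
    proof -
      have "\<bar>u t - u 0\<bar> \<le> (2 * (\<epsilon>1 * \<rho>)) * (t - 0)"
      proof (rule has_integral_abs_bound)
        show "((\<lambda>r. mink_slope (w r)) has_integral u t - u 0) {0..t}"
          using traj_slope_has_integral[OF traj, of 0 t] t by simp
        fix r assume "r \<in> {0..t}"
        then have "\<bar>w r\<bar> \<le> 2 * (\<epsilon>1 * \<rho>)" using w_close[of r] w0_small t by auto
        then show "\<bar>mink_slope (w r)\<bar> \<le> 2 * (\<epsilon>1 * \<rho>)" using abs_mink_slope_le[of "w r"] by simp
      qed (use t in simp)
      also have "\<dots> \<le> (2 * (\<epsilon>1 * \<rho>)) * T"
        using t \<epsilon>1 \<rho> by (intro mult_left_mono) auto
      also have "\<dots> = (2 * T * \<epsilon>1) * \<rho>" by simp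
      also have "\<dots> \<le> (2 * T * \<epsilon>1) * (2 * \<bar>u 0\<bar>)"
        using u0_big \<epsilon>1 T_pos by (intro mult_left_mono) auto
      also have "\<dots> = (4 * T * \<epsilon>1) * \<bar>u 0\<bar>" by simp
      also have "\<dots> \<le> min d2 1 / 2 * \<bar>u 0\<bar>" using \<epsilon>1(3) by (intro mult_right_mono) auto
      finally show ?thesis .
    qed
    have u0_nz: "u 0 \<noteq> 0" using u0_big \<rho> by auto
    have half: "\<bar>u t - u 0\<bar> \<le> \<bar>u 0\<bar> / 2" if "t \<in> {0..T}" for t
    proof -
      have "min d2 1 / 2 * \<bar>u 0\<bar> \<le> 1 / 2 * \<bar>u 0\<bar>" by (intro mult_right_mono) auto
      then show ?thesis using u_close[OF that] by simp
    qed
    show False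
    proof (cases "0 < u 0")
      case False
      then have "u t < 0" if "t \<in> {0..T}" for t using half[OF that] u0_nz by auto
      then have "w T < w 0" using T_pos by (intro traj_w_decreasing_of_neg[OF traj]) auto
      moreover have "c * u 0 \<le> 0" using False c by (simp add: mult_le_0_iff)
      ultimately show False using bc2 by simp
    next
      case True
      have gu0: "0 < g (u 0)" by (rule g_pos[OF True])
      have "w 0 - w T \<le> g (u 0) * (integral {0..T} a + C * \<epsilon>3 * T)"
      proof (rule has_integral_le)
        show "((\<lambda>r. force r (u r)) has_integral w 0 - w T) {0..T}"
          using traj_force_has_integral[OF traj, of 0 T] T_pos by simp
        have "((\<lambda>r. a r + C * \<epsilon>3) has_integral integral {0..T} a + C * \<epsilon>3 * T) {0..T}"
          using has_integral_add[OF integrable_integral[OF weight_integrable[of 0 T]]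
              has_integral_const_real[of "C * \<epsilon>3" 0 T]] T_pos by (simp add: mult.commute)
        then show "((\<lambda>r. g (u 0) * (a r + C * \<epsilon>3)) has_integral g (u 0) * (integral {0..T} a + C * \<epsilon>3 * T)) {0..T}"
          by (rule has_integral_mult_right)
        fix r assume r: "r \<in> {0..T}"
        have ur: "0 \<le> u r" using half[OF r] True by (simp only: abs_of_pos abs_le_iff) linarith
        \<comment> \<open>\<open>\<omega>\<close> is the ratio close to \<open>1\<close> in the regular oscillation of \<open>g\<close>\<close>
        define \<omega> where "\<omega> = u r / u 0"
        have \<omega>: "\<omega> * u 0 = u r" using True by (simp add: \<omega>_def)
        have "\<bar>\<omega> - 1\<bar> * u 0 = \<bar>(\<omega> - 1) * u 0\<bar>" using True by (simp add: abs_mult)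
        also have "\<dots> = \<bar>u r - u 0\<bar>" by (simp add: left_diff_distrib \<omega>)
        also have "\<dots> \<le> min d2 1 / 2 * u 0" using u_close[OF r] True by simp
        finally have "\<bar>\<omega> - 1\<bar> \<le> min d2 1 / 2" using True by simp
        then have "\<bar>\<omega> - 1\<bar> < d2" using d(2) by linarith
        then have "\<bar>g (\<omega> * u 0) / g (u 0) - 1\<bar> < \<epsilon>3" using True u0 \<rho> \<rho>0 by (intro d(3)) auto
        then have "\<bar>g (u r) / g (u 0) - 1\<bar> * g (u 0) \<le> \<epsilon>3 * g (u 0)"
          using gu0 by (intro mult_right_mono) (auto simp: \<omega>)
        then have "\<bar>(g (u r) / g (u 0) - 1) * g (u 0)\<bar> \<le> \<epsilon>3 * g (u 0)"
          using gu0 by (simp add: abs_mult)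
        then have dev: "\<bar>g (u r) - g (u 0)\<bar> \<le> \<epsilon>3 * g (u 0)"
          using gu0 by (simp add: left_diff_distrib)
        have "a r * (g (u r) - g (u 0)) \<le> \<bar>a r\<bar> * \<bar>g (u r) - g (u 0)\<bar>" by (metis abs_ge_self abs_mult)
        also have "\<dots> \<le> C * (\<epsilon>3 * g (u 0))" using a_le[OF r] dev C_nonneg by (intro mult_mono) auto
        finally show "force r (u r) \<le> g (u 0) * (a r + C * \<epsilon>3)"
          using ur by (simp add: force_def gpos_simps gneg_simps algebra_simps)
      qed
      also have "\<dots> < 0" using gu0 \<epsilon>3(2) by (simp add: mult_less_0_iff)
      finally have "w 0 < w T" by simp
      moreover have "0 \<le> c * u 0" using True c by simp
      ultimately show False using bc2 by simp
    qed
  qed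
qed

text \<open>The estimate on the outer circle. As \<open>\<bar>u'\<bar> < 1\<close>, a large value \<open>u 0\<close> makes \<open>u\<close> large everywhere. On
the interval \<open>[\<sigma>, \<tau>]\<close>, where the weight is nonnegative, \<open>w\<close> decreases. According to the sign of \<open>w\<close>
at the midpoint, \<open>u\<close> is monotone on the quarter to the right or to the left of it, and over this
quarter \<open>w\<close> drops by at least \<open>A g(x)\<close>, where \<open>x\<close> is the value of \<open>u\<close> at the outer end, the smallest
one there. So \<open>\<bar>w\<bar> \<ge> A g(x)\<close> at that end, and by the growth condition \<open>A g(x)\<close> exceeds the bound
\<open>1 + N G(x)\<close> that the energy imposes at the same point. Comparison at a single point matters here,
because \<open>g\<close> grows at least exponentially and its values at different points of the trajectory
need not be comparable. Once \<open>u 0\<close> is bounded, the same energy bound controls \<open>w 0\<close>.\<close>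

lemma no_large_trajectory:
  assumes N: "0 \<le> N" "\<And>t. t \<in> {0..T} \<Longrightarrow> - N \<le> a t"
    and \<sigma>\<tau>: "0 \<le> \<sigma>" "\<sigma> < \<tau>" "\<tau> \<le> T" and a_nonneg: "\<And>t. t \<in> {\<sigma>..\<tau>} \<Longrightarrow> 0 \<le> a t"
    and A: "0 < A" "\<And>t. \<sigma> \<le> t \<Longrightarrow> t + (\<tau> - \<sigma>) / 4 \<le> \<tau> \<Longrightarrow> A \<le> integral {t..t + (\<tau> - \<sigma>) / 4} a"
    and growth: "N < c * A" "\<And>x. R1 \<le> x \<Longrightarrow> c * integral {0..x} g \<le> g x"
    and mono: "0 < R2" "mono_on {R2..} g"
  obtains R where "0 < R"
    "\<And>u w. trajectory u w \<Longrightarrow> u T = u 0 \<or> w 0 = 0 \<Longrightarrow> w 0 \<le> w T \<Longrightarrow> norm (u 0, w 0) < R"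
proof -
  let ?G = "\<lambda>x. integral {0..x} g"
  have gint: "g integrable_on {x..y}" if "0 \<le> x" for x y
    by (intro integrable_continuous_real continuous_on_subset[OF g_cont]) (use that in auto)
  have G_nonneg: "0 \<le> ?G x" for x
    by (rule Henstock_Kurzweil_Integration.integral_nonneg[OF gint]) (auto intro: g_nonneg)
  have G_mono: "?G x \<le> ?G y" if "x \<le> y" for x y
    by (rule integral_subset_le) (use that gint g_nonneg in auto)
  define e where "e = c * A - N"
  have e: "0 < e" using growth by (simp add: e_def)
  have gR2: "0 < g R2" by (rule g_pos[OF mono(1)])
  \<comment> \<open>beyond this value the surplus \<open>e * ?G\<close> of the growth condition is at least \<open>2\<close>\<close>
  define R3 where "R3 = max R1 (R2 + 2 / (e * g R2))"
  have R3: "R1 \<le> R3" "R2 + 2 / (e * g R2) \<le> R3" by (auto simp: R3_def)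
  have R32: "R2 \<le> R3" using R3(2) e gR2 by (smt (verit) divide_nonneg_pos mult_pos_pos)
  have key: "1 + N * ?G x < A * g x" if x: "R3 \<le> x" for x
  proof -
    have "g R2 * (x - R2) \<le> integral {R2..x} g"
    proof (rule has_integral_le)
      show "((\<lambda>_. g R2) has_integral g R2 * (x - R2)) {R2..x}"
        using has_integral_const_real[of "g R2" R2 x] x R32 by (simp add: mult.commute)
      show "(g has_integral integral {R2..x} g) {R2..x}" using gint[of R2 x] mono(1) by (simp add: integrable_integral)
      show "g R2 \<le> g y" if "y \<in> {R2..x}" for y
        using mono_onD[OF mono(2), of R2 y] that by auto
    qed
    also have "\<dots> \<le> ?G x" by (rule integral_subset_le) (use mono(1) gint g_nonneg in auto)
    finally have "g R2 * (x - R2) \<le> ?G x" .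
    moreover have "2 / (e * g R2) \<le> x - R2" using x R3 by simp
    then have "(e * g R2) * (2 / (e * g R2)) \<le> (e * g R2) * (x - R2)"
      using e gR2 by (intro mult_left_mono) auto
    then have "2 \<le> e * (g R2 * (x - R2))" using e gR2 by (simp add: mult.assoc)
    ultimately have "2 \<le> e * ?G x" using e by (smt (verit) mult_left_mono)
    moreover have "A * (c * ?G x) \<le> A * g x" using growth(2)[of x] x R3 A by (intro mult_left_mono) auto
    ultimately show ?thesis by (simp add: e_def algebra_simps)
  qed
  define R4 where "R4 = R3 + T"
  have R4: "0 < R4" using mono(1) R32 T_pos by (simp add: R4_def)
  have bound: "norm (u 0, w 0) < R4 + (1 + N * ?G R4)"
    if traj: "trajectory u w" and bc: "u T = u 0 \<or> w 0 = 0" and wT: "w 0 \<le> w T" for u w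
  proof -
    have nonneg: "0 \<le> u t" if "t \<in> {0..T}" for t by (rule traj_nonneg[OF traj wT bc that])
    have slope: "\<bar>w t\<bar> \<le> 1 + N * ?G (u t)" if t: "t \<in> {0..T}" for t
    proof -
      have "sqrt ((w t)\<^sup>2) \<le> sqrt (1 + (w t)\<^sup>2)" by (intro real_sqrt_le_mono) simp
      moreover have "energy N (u t) (w t) \<le> 1" by (rule energy_le_1[OF traj nonneg N wT bc t])
      ultimately show ?thesis by (simp add: energy_def)
    qed
    have u0: "u 0 < R4"
    proof (rule ccontr)
      assume "\<not> u 0 < R4"
      have big: "R3 \<le> u t" if t: "t \<in> {0..T}" for t
        using traj_u_lipschitz[OF traj _ t, of 0] t \<open>\<not> u 0 < R4\<close> by (auto simp: R4_def)
      define l where "l = (\<tau> - \<sigma>) / 4"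
      have l: "0 < l" "\<sigma> + 2 * l + 2 * l = \<tau>" using \<sigma>\<tau> by (auto simp: l_def field_simps)
      have force_eq: "force r (u r) = a r * g (u r)" if "r \<in> {0..T}" for r
        using nonneg[OF that] by (simp add: force_def gpos_simps gneg_simps)
      have w_mono: "w t \<le> w s" if "\<sigma> \<le> s" "s \<le> t" "t \<le> \<tau>" for s t
      proof -
        have "0 \<le> w s - w t"
        proof (rule has_integral_nonneg[OF traj_force_has_integral[OF traj]])
          fix r assume "r \<in> {s..t}"
          then have r: "r \<in> {0..T}" "r \<in> {\<sigma>..\<tau>}" using that \<sigma>\<tau> by auto
          show "0 \<le> force r (u r)"
            unfolding force_eq[OF r(1)] using a_nonneg[OF r(2)] g_nonneg[OF nonneg[OF r(1)]] by simp
        qed (use that \<sigma>\<tau> in auto)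
        then show ?thesis by simp
      qed
      have drop: "A * g (u p) \<le> w t - w (t + l)"
        if t: "\<sigma> \<le> t" "t + l \<le> \<tau>" and p: "p \<in> {0..T}" "\<And>r. r \<in> {t..t + l} \<Longrightarrow> u p \<le> u r" for t p
      proof -
        have g0: "0 \<le> g (u p)" by (rule g_nonneg[OF nonneg[OF p(1)]])
        have "A * g (u p) \<le> integral {t..t + l} a * g (u p)"
          using A(2)[of t] t g0 unfolding l_def by (intro mult_right_mono) auto
        also have "\<dots> \<le> w t - w (t + l)"
        proof (rule has_integral_le)
          have "a integrable_on {t..t + l}" using t \<sigma>\<tau> by (intro weight_integrable) auto
          then show "((\<lambda>r. a r * g (u p)) has_integral integral {t..t + l} a * g (u p)) {t..t + l}"
            by (intro has_integral_mult_left integrable_integral)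
          show "((\<lambda>r. force r (u r)) has_integral w t - w (t + l)) {t..t + l}"
            by (rule traj_force_has_integral[OF traj]) (use t \<sigma>\<tau> l in auto)
          fix r assume r: "r \<in> {t..t + l}"
          then have r': "r \<in> {0..T}" "r \<in> {\<sigma>..\<tau>}" using t \<sigma>\<tau> by auto
          have "g (u p) \<le> g (u r)"
            using mono_onD[OF mono(2), of "u p" "u r"] p(2)[OF r] big[OF p(1)] big[OF r'(1)] R32 by auto
          then show "a r * g (u p) \<le> force r (u r)"
            unfolding force_eq[OF r'(1)] using a_nonneg[OF r'(2)] by (intro mult_left_mono) auto
        qed
        finally show ?thesis .
      qed
      define mid where "mid = \<sigma> + 2 * l"
      show False
      proof (cases "w mid \<le> 0")
        case True
        have in_T: "mid + l \<in> {0..T}" using l \<sigma>\<tau> by (auto simp: mid_def)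
        have "w r \<le> 0" if "r \<in> {mid..mid + l}" for r
          using w_mono[of mid r] that True l by (auto simp: mid_def)
        then have "u (mid + l) \<le> u r" if "r \<in> {mid..mid + l}" for r
          using that in_T l \<sigma>\<tau> by (intro traj_u_antimono[OF traj]) (auto simp: mid_def)
        then have "A * g (u (mid + l)) \<le> w mid - w (mid + l)"
          using l \<sigma>\<tau> in_T by (intro drop) (auto simp: mid_def)
        then show False using True slope[OF in_T] key[OF big[OF in_T]] by linarith
      next
        case False
        have in_T: "mid - l \<in> {0..T}" using l \<sigma>\<tau> by (auto simp: mid_def)
        have "0 \<le> w r" if "r \<in> {mid - l..mid}" for r
          using w_mono[of r mid] that False l by (auto simp: mid_def)
        then have "u (mid - l) \<le> u r" if "r \<in> {mid - l..mid}" for r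
          using that in_T l \<sigma>\<tau> by (intro traj_u_mono[OF traj]) (auto simp: mid_def)
        then have "A * g (u (mid - l)) \<le> w (mid - l) - w (mid - l + l)"
          using l \<sigma>\<tau> in_T by (intro drop) (auto simp: mid_def)
        then show False using False slope[OF in_T] key[OF big[OF in_T]] by simp
      qed
    qed
    have z: "0 \<in> {0..T}" using T_pos by simp
    have "N * ?G (u 0) \<le> N * ?G R4" using u0 N(1) by (intro mult_left_mono G_mono) auto
    then have "\<bar>w 0\<bar> \<le> 1 + N * ?G R4" using slope[OF z] by simp
    then show ?thesis
      using norm_Pair_le[of "u 0" "w 0"] u0 nonneg[OF z] by simp
  qed
  have "0 < R4 + (1 + N * ?G R4)" using R4 N(1) G_nonneg[of R4] by (simp add: add_pos_nonneg)
  from this bound show thesis by (rule that)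
qed

end

section \<open>Solution of the boundary value problem\<close>

context mink_system
begin

text \<open>The two forms of \<open>\<Phi>\<close> measure the defect in the periodic and in the Neumann condition for an initial
state \<open>z\<close> and a final state \<open>y\<close>. With the Euler map in place of the flow, \<open>\<Phi>\<close> becomes a continuous
planar map \<open>F n\<close> of the initial state. A configuration that the planar existence principle forbids on
one of the circles, if present for infinitely many \<open>n\<close>, would by compactness be present for a
trajectory, against the a priori estimates. So \<open>F n\<close> has zeros in the annulus for all large \<open>n\<close>, and
compactness turns these into a trajectory.\<close>

lemma boundary_value_trajectory:
  fixes \<Phi> :: "(real \<times> real) \<times> (real \<times> real) \<Rightarrow> real \<times> real"
  assumes \<Phi>: "\<Phi> = (\<lambda>(z, y). y - z) \<or> \<Phi> = (\<lambda>(z, y). (snd z, snd y))"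
    and small: "0 < \<rho>0"
      "\<And>u w c. trajectory u w \<Longrightarrow> norm (u 0, w 0) < \<rho>0 \<Longrightarrow> (u 0, w 0) \<noteq> 0 \<Longrightarrow> 0 \<le> c \<Longrightarrow>
        u T - u 0 = - c * w 0 \<or> w 0 = 0 \<Longrightarrow> w T - w 0 = - c * u 0 \<Longrightarrow> False"
    and large: "0 < R"
      "\<And>u w. trajectory u w \<Longrightarrow> u T = u 0 \<or> w 0 = 0 \<Longrightarrow> w 0 \<le> w T \<Longrightarrow> norm (u 0, w 0) < R"
  obtains u w where "trajectory u w" "(u 0, w 0) \<noteq> 0" "\<Phi> ((u 0, w 0), (u T, w T)) = 0"
proof -
  have cont: "continuous_on UNIV \<Phi>"
    using \<Phi> by (auto simp: case_prod_beta intro!: continuous_intros)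
  have cont': "continuous_on A (\<lambda>x. \<Phi> (f x))" if "continuous_on A f" for A and f :: "'b::topological_space \<Rightarrow> _"
    using continuous_on_compose2[OF cont that] by simp
  have swap: "continuous_on A (\<lambda>x. prod.swap (f x))" if "continuous_on A f"
    for A and f :: "'b::topological_space \<Rightarrow> real \<times> real"
    unfolding prod.swap_def using that by (intro continuous_intros)
  define \<rho> where "\<rho> = min (\<rho>0 / 2) R"
  have \<rho>: "0 < \<rho>" "\<rho> < \<rho>0" "\<rho> \<le> R" using small(1) large(1) by (auto simp: \<rho>_def)
  define F where "F n z = \<Phi> (z, euler (T / real n) z n)" for n z
  have contF: "continuous_on UNIV (F n)" for n
    unfolding F_def[abs_def] by (intro cont' continuous_intros continuous_on_euler)
  have inner: "\<exists>n0. \<forall>n\<ge>n0. \<forall>z c. norm z = \<rho> \<longrightarrow> 0 \<le> c \<longrightarrow> F n z \<noteq> - c *\<^sub>R prod.swap z"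
  proof (rule ccontr)
    assume "\<not> ?thesis"
    then have freq: "\<exists>n\<ge>n0. \<exists>z c. norm z = \<rho> \<and> 0 \<le> c \<and> F n z = - c *\<^sub>R prod.swap z" for n0 by meson
    \<comment> \<open>\<open>\<Phi>\<close> is a nonpositive multiple of the swapped initial state, written as a closed condition\<close>
    let ?P = "{p. norm (fst p) = \<rho> \<and> \<rho> *\<^sub>R \<Phi> p + norm (\<Phi> p) *\<^sub>R prod.swap (fst p) = 0}"
    have "closed ?P"
      by (intro closed_Collect_conj closed_Collect_eq continuous_intros cont' swap)
    moreover have "\<exists>n\<ge>n0. \<exists>z. norm z \<le> \<rho> \<and> (z, euler (T / real n) z n) \<in> ?P" for n0
    proof -
      obtain n z c where n: "n0 \<le> n" and z: "norm z = \<rho>" "0 \<le> c" "F n z = - c *\<^sub>R prod.swap z"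
        using freq by blast
      have "norm (prod.swap z) = norm z" by (cases z) (simp add: norm_Pair add.commute)
      then have "norm (F n z) = c * \<rho>" using z by simp
      then have "(z, euler (T / real n) z n) \<in> ?P"
        using z by (simp add: mult.commute flip: F_def)
      then show ?thesis using n z by (intro exI[of _ n] conjI exI[of _ z]) auto
    qed
    ultimately obtain u w where traj: "trajectory u w" and P: "((u 0, w 0), (u T, w T)) \<in> ?P"
      by (rule euler_limit)
    let ?\<Phi> = "\<Phi> ((u 0, w 0), (u T, w T))"
    define c where "c = norm ?\<Phi> / \<rho>"
    have c: "0 \<le> c" using \<rho> by (simp add: c_def)
    have "\<rho> *\<^sub>R ?\<Phi> + norm ?\<Phi> *\<^sub>R (w 0, u 0) = 0" using P by simp
    moreover have "norm ?\<Phi> = \<rho> * c" using \<rho> by (simp add: c_def)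
    ultimately have "\<rho> *\<^sub>R (?\<Phi> + c *\<^sub>R (w 0, u 0)) = 0"
      by (simp only: scaleR_add_right scaleR_scaleR)
    then have eq: "?\<Phi> = - c *\<^sub>R (w 0, u 0)"
      using \<rho>(1) by (simp only: scaleR_eq_0_iff eq_neg_iff_add_eq_0 scaleR_minus_left) auto
    have nrm: "norm (u 0, w 0) = \<rho>" using P by simp
    then have nz: "(u 0, w 0) \<noteq> 0" "norm (u 0, w 0) < \<rho>0" using \<rho> by auto
    have "(u T - u 0 = - c * w 0 \<or> w 0 = 0) \<and> w T - w 0 = - c * u 0"
      using \<Phi>
    proof
      assume "\<Phi> = (\<lambda>(z, y). y - z)"
      then show ?thesis using eq by simp
    next
      assume "\<Phi> = (\<lambda>(z, y). (snd z, snd y))"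
      then have "(1 + c) * w 0 = 0" "w T = - c * u 0" using eq by (auto simp: algebra_simps)
      then show ?thesis using c by (simp add: add_nonneg_eq_0_iff)
    qed
    then show False using small(2)[OF traj nz(2,1) c] by blast
  qed
  have outer: "\<exists>n0. \<forall>n\<ge>n0. \<forall>z c. norm z = R \<longrightarrow> 0 \<le> c \<longrightarrow> F n z \<noteq> (0, c)"
  proof (rule ccontr)
    assume "\<not> ?thesis"
    then have freq: "\<exists>n\<ge>n0. \<exists>z c. norm z = R \<and> 0 \<le> c \<and> F n z = (0, c)" for n0 by meson
    let ?P = "{p. norm (fst p) = R \<and> fst (\<Phi> p) = 0 \<and> 0 \<le> snd (\<Phi> p)}"
    have "closed ?P"
      by (intro closed_Collect_conj closed_Collect_eq closed_Collect_le continuous_intros cont')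
    moreover have "\<exists>n\<ge>n0. \<exists>z. norm z \<le> R \<and> (z, euler (T / real n) z n) \<in> ?P" for n0
    proof -
      obtain n z c where n: "n0 \<le> n" and z: "norm z = R" "0 \<le> c" "F n z = (0, c)"
        using freq by blast
      then have "(z, euler (T / real n) z n) \<in> ?P" by (simp flip: F_def)
      then show ?thesis using n z by (intro exI[of _ n] conjI exI[of _ z]) auto
    qed
    ultimately obtain u w where traj: "trajectory u w" and P: "((u 0, w 0), (u T, w T)) \<in> ?P"
      by (rule euler_limit)
    have "(u T = u 0 \<or> w 0 = 0) \<and> w 0 \<le> w T" using \<Phi> P by auto
    then have "norm (u 0, w 0) < R" using large(2)[OF traj] by blast
    then show False using P by simp
  qed
  obtain n1 where n1: "\<And>n z c. n1 \<le> n \<Longrightarrow> norm z = \<rho> \<Longrightarrow> 0 \<le> c \<Longrightarrow> F n z \<noteq> - c *\<^sub>R prod.swap z"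
    using inner by blast
  obtain n2 where n2: "\<And>n z c. n2 \<le> n \<Longrightarrow> norm z = R \<Longrightarrow> 0 \<le> c \<Longrightarrow> F n z \<noteq> (0, c)"
    using outer by blast
  have zero: "\<exists>z. \<rho> \<le> norm z \<and> norm z \<le> R \<and> F n z = 0" if "max n1 n2 \<le> n" for n
    by (rule planar_zero_in_annulus[OF contF \<rho>(1,3)]) (use n1 n2 that in auto)
  let ?P = "{p. \<rho> \<le> norm (fst p) \<and> \<Phi> p = 0}"
  have "closed ?P"
    by (intro closed_Collect_conj closed_Collect_eq closed_Collect_le continuous_intros cont')
  moreover have "\<exists>n\<ge>n0. \<exists>z. norm z \<le> R \<and> (z, euler (T / real n) z n) \<in> ?P" for n0
  proof -
    obtain z where z: "\<rho> \<le> norm z" "norm z \<le> R" "F (max n0 (max n1 n2)) z = 0"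
      using zero[of "max n0 (max n1 n2)"] by auto
    then show ?thesis
      by (intro exI[of _ "max n0 (max n1 n2)"] conjI exI[of _ z]) (auto simp: F_def)
  qed
  ultimately obtain u w where traj: "trajectory u w" and P: "((u 0, w 0), (u T, w T)) \<in> ?P"
    by (rule euler_limit)
  have "(u 0, w 0) \<noteq> 0"
  proof
    assume "(u 0, w 0) = 0"
    then have "norm (u 0, w 0) = 0" by (simp only: norm_zero)
    then show False using P \<rho>(1) by simp
  qed
  then show thesis using that traj P by blast
qed

lemma Icc_deriv_trajectory:
  assumes "trajectory u w" "t \<in> {0..T}"
  shows "Icc_deriv T u t = mink_slope (w t)"
  unfolding Icc_deriv_def
  using traj_u_derivative[OF assms] T_pos assms(2)
  by (intro vector_derivative_within_closed_interval)
    (auto simp: has_real_derivative_iff_has_vector_derivative)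

text \<open>The variable \<open>w\<close> is the function \<open>u' / sqrt (1 - u'\<^sup>2)\<close> of the definition of a solution. It is
Lipschitz, hence absolutely continuous, and as an indefinite integral it is differentiable almost
everywhere.\<close>

lemma trajectory_is_positive_solution:
  assumes traj: "trajectory u w" and pos: "\<And>t. t \<in> {0..T} \<Longrightarrow> 0 < u t" and B: "B u = (0, 0)"
    and a': "AE t\<in>{0..T} in lebesgue. a t = a' t"
  shows "is_positive_solution T B a' g u"
proof -
  define v where "v t = Icc_deriv T u t / sqrt (1 - (Icc_deriv T u t)\<^sup>2)" for t
  have v: "v t = w t" if "t \<in> {0..T}" for t
    using Icc_deriv_trajectory[OF traj that] mink_slope_inverse[of "w t"] by (simp add: v_def)
  have z: "0 \<in> {0..T}" using T_pos by simp
  have "C1_Icc T u"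
    unfolding C1_Icc_def
  proof
    show "u differentiable_on {0..T}"
      unfolding differentiable_on_def
      using traj_u_derivative[OF traj] real_differentiable_def by blast
    have "continuous_on {0..T} (\<lambda>t. mink_slope (w t))"
      by (intro continuous_intros traj_continuous(2)[OF traj])
    then show "continuous_on {0..T} (Icc_deriv T u)"
      by (rule continuous_on_eq) (simp add: Icc_deriv_trajectory[OF traj])
  qed
  moreover have "\<bar>Icc_deriv T u t\<bar> < 1" if "t \<in> {0..T}" for t
    using Icc_deriv_trajectory[OF traj that] abs_mink_slope_less_1 by simp
  moreover have "abs_continuous_Icc 0 T v"
    unfolding abs_continuous_Icc_def
  proof (intro allI impI)
    fix \<epsilon> :: real assume "0 < \<epsilon>"
    obtain K where K: "0 \<le> K"
      "\<And>t x. t \<in> {0..T} \<Longrightarrow> \<bar>x\<bar> \<le> \<bar>u 0\<bar> + T \<Longrightarrow> \<bar>force t x\<bar> \<le> K"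
      using force_bound[where R = "\<bar>u 0\<bar> + T"] by blast
    have lip: "\<bar>w t - w s\<bar> \<le> K * (t - s)" if st: "0 \<le> s" "s \<le> t" "t \<le> T" for s t
    proof -
      have "\<bar>w s - w t\<bar> \<le> K * (t - s)"
      proof (rule has_integral_abs_bound[OF traj_force_has_integral[OF traj st] st(2)])
        fix r assume "r \<in> {s..t}"
        then have r: "r \<in> {0..T}" using st by auto
        have "\<bar>u r\<bar> \<le> \<bar>u 0\<bar> + T" using traj_u_lipschitz[OF traj z r] r by auto
        then show "\<bar>force r (u r)\<bar> \<le> K" by (rule K(2)[OF r])
      qed
      then show ?thesis by (simp add: abs_minus_commute)
    qed
    have small: "(\<Sum>i<n. \<bar>v (y i) - v (x i)\<bar>) < \<epsilon>"
      if xy: "\<forall>i<n. 0 \<le> x i \<and> x i \<le> y i \<and> y i \<le> T" "(\<Sum>i<n. y i - x i) < \<epsilon> / (K + 1)"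
      for n :: nat and x y
    proof -
      have "(\<Sum>i<n. \<bar>v (y i) - v (x i)\<bar>) \<le> (\<Sum>i<n. (K + 1) * (y i - x i))"
      proof (rule sum_mono)
        fix i assume "i \<in> {..<n}"
        then have i: "0 \<le> x i" "x i \<le> y i" "y i \<le> T" using xy(1) by auto
        then have "\<bar>v (y i) - v (x i)\<bar> \<le> K * (y i - x i)" using lip v by simp
        also have "\<dots> \<le> (K + 1) * (y i - x i)" using i by (intro mult_right_mono) auto
        finally show "\<bar>v (y i) - v (x i)\<bar> \<le> (K + 1) * (y i - x i)" .
      qed
      also have "\<dots> = (K + 1) * (\<Sum>i<n. y i - x i)" by (simp add: sum_distrib_left)
      also have "\<dots> < (K + 1) * (\<epsilon> / (K + 1))" using xy(2) K by (intro mult_strict_left_mono) auto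
      also have "\<dots> = \<epsilon>" using K by simp
      finally show ?thesis .
    qed
    show "\<exists>\<delta>>0. \<forall>(n::nat) x y. (\<forall>i<n. 0 \<le> x i \<and> x i \<le> y i \<and> y i \<le> T) \<and>
        disjoint_family_on (\<lambda>i. {x i<..<y i}) {..<n} \<and> (\<Sum>i<n. y i - x i) < \<delta> \<longrightarrow>
        (\<Sum>i<n. \<bar>v (y i) - v (x i)\<bar>) < \<epsilon>"
    proof (intro exI[of _ "\<epsilon> / (K + 1)"] conjI allI impI)
      show "0 < \<epsilon> / (K + 1)" using \<open>0 < \<epsilon>\<close> K by simp
      fix n :: nat and x y :: "nat \<Rightarrow> real"
      assume "(\<forall>i<n. 0 \<le> x i \<and> x i \<le> y i \<and> y i \<le> T) \<and>
        disjoint_family_on (\<lambda>i. {x i<..<y i}) {..<n} \<and> (\<Sum>i<n. y i - x i) < \<epsilon> / (K + 1)"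
      then show "(\<Sum>i<n. \<bar>v (y i) - v (x i)\<bar>) < \<epsilon>" by (elim conjE) (rule small)
    qed
  qed
  moreover have "AE t\<in>{0..T} in lebesgue.
      \<exists>D. (v has_real_derivative D) (at t within {0..T}) \<and> D + a' t * g (u t) = 0"
  proof -
    have "(\<lambda>s. force s (u s)) integrable_on {0..T}"
      by (intro force_integrable traj_continuous(1)[OF traj]) auto
    from indefinite_integral_AE_derivative[OF this] obtain Z where Z: "negligible Z" "\<And>t. t \<in> {0<..<T} - Z \<Longrightarrow>
        ((\<lambda>t. integral {0..t} (\<lambda>s. force s (u s))) has_real_derivative force t (u t)) (at t)"
      by metis
    have "negligible (Z \<union> {0, T})" using Z(1) by (simp add: negligible_Un)
    then have "AE t in lebesgue. t \<notin> Z \<union> {0, T}"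
      by (simp only: negligible_iff_null_sets AE_not_in)
    with a' show ?thesis
    proof eventually_elim
      fix t assume a'': "t \<in> {0..T} \<longrightarrow> a t = a' t" and tZ: "t \<notin> Z \<union> {0, T}"
      show "t \<in> {0..T} \<longrightarrow> (\<exists>D. (v has_real_derivative D) (at t within {0..T}) \<and> D + a' t * g (u t) = 0)"
      proof
        assume t: "t \<in> {0..T}"
        then have "t \<in> {0<..<T} - Z" using tZ by auto
        from DERIV_subset[OF Z(2)[OF this] subset_UNIV, of "{0..T}"]
        have "((\<lambda>t. w 0 - integral {0..t} (\<lambda>s. force s (u s))) has_real_derivative - force t (u t)) (at t within {0..T})"
          by (auto intro!: derivative_eq_intros)
        then have "(v has_real_derivative - force t (u t)) (at t within {0..T})"
        proof (rule has_field_derivative_transform_within[OF _ zero_less_one t])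
          fix r assume r: "r \<in> {0..T}"
          then show "w 0 - integral {0..r} (\<lambda>s. force s (u s)) = v r"
            using integral_unique[OF traj_force_has_integral[OF traj, of 0 r]] v by simp
        qed
        moreover have "- force t (u t) + a' t * g (u t) = 0"
          using a'' t pos[OF t] by (simp add: force_def gpos_simps gneg_simps)
        ultimately show "\<exists>D. (v has_real_derivative D) (at t within {0..T}) \<and> D + a' t * g (u t) = 0"
          by blast
      qed
    qed
  qed
  moreover have "0 \<le> u t" if "t \<in> {0..T}" for t using pos[OF that] by simp
  ultimately have "is_solution T B a' g u"
    using B unfolding is_solution_def Let_def v_def[abs_def] by blast
  then show ?thesis using pos unfolding is_positive_solution_def by blast
qed

end

text \<open>What remains is to extract numerical data from the hypotheses: \<open>N\<close> is the supremum norm of the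
negative part of \<open>a\<close>, the window is the first interval of positivity, and \<open>c\<close> lies strictly between
the two sides of the growth condition.\<close>

theorem theorem2p1:
  fixes T :: real
    and B :: "(real \<Rightarrow> real) \<Rightarrow> real \<times> real"
    and a g :: "real \<Rightarrow> real"
    and m :: nat
    and \<sigma> \<tau> :: "nat \<Rightarrow> real"
  assumes T_pos: "T > 0"
    and B: "B = periodic_op T \<or> B = neumann_op T"
    and a_meas: "a \<in> borel_measurable (lebesgue_on {0..T})"
    and a_bdd: "\<exists>C. AE t\<in>{0..T} in lebesgue. \<bar>a t\<bar> \<le> C"
    and m: "m \<ge> 1"
    and endpoints: "\<tau> 0 = 0" "\<tau> 0 \<le> \<sigma> 1" "\<tau> m \<le> \<sigma> (m + 1)" "\<sigma> (m + 1) = T"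
    and sigma_tau: "\<forall>i\<in>{1..m}. \<sigma> i < \<tau> i"
    and tau_sigma: "\<forall>i\<in>{1..<m}. \<tau> i < \<sigma> (i + 1)"
    and a_pos: "\<forall>i\<in>{1..m}. AE t\<in>{\<sigma> i..\<tau> i} in lebesgue. a t > 0"
    and a_nonpos: "\<forall>i\<in>{0..m}. AE t\<in>{\<tau> i..\<sigma> (i + 1)} in lebesgue. a t \<le> 0"
    and a_mean: "(LINT t:{0..T}|lebesgue. a t) < 0"
    and g_cont: "continuous_on {0..} g"
    and g_nonneg: "\<forall>u\<ge>0. g u \<ge> 0"
    and g_zero: "g 0 = 0"
    and g_pos: "\<forall>u>0. g u > 0"
    and g_superlinear: "((\<lambda>u. g u / u) \<longlongrightarrow> 0) (at_right 0)"
    and g_regular: "((\<lambda>(u, \<omega>). g (\<omega> * u) / g u) \<longlongrightarrow> 1) (at_right 0 \<times>\<^sub>F at 1)"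
    and g_mono: "\<exists>R>0. mono_on {R..} g"
    and g_growth: "Liminf at_top (\<lambda>u. ereal (g u / integral {0..u} g)) >
        Linf_norm 0 T (neg_part a) / ereal (Min ((\<lambda>i. A_min a (\<sigma> i) (\<tau> i)) ` {1..m}))"
  shows "\<exists>u. is_positive_solution T B a g u"
proof -
  obtain C0 where C0: "AE t\<in>{0..T} in lebesgue. \<bar>a t\<bar> \<le> C0" using a_bdd by blast
  have \<sigma>_nonneg: "0 \<le> \<sigma> i" if "i \<in> {1..m}" for i
    using that
  proof (induction i)
    case (Suc i)
    show ?case
    proof (cases "i = 0")
      case True
      then show ?thesis using endpoints by simp
    next
      case False
      then have "0 \<le> \<sigma> i" "\<sigma> i < \<tau> i" "\<tau> i < \<sigma> (i + 1)"
        using Suc sigma_tau tau_sigma by auto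
      then show ?thesis by simp
    qed
  qed simp
  have \<tau>_le: "\<tau> i \<le> T" if "i \<in> {1..m}" for i
  proof -
    have "i \<le> m" using that by simp
    then show ?thesis using that
    proof (induction i rule: inc_induct)
      case base
      then show ?case using endpoints by simp
    next
      case (step i)
      then have "\<tau> i < \<sigma> (i + 1)" "\<sigma> (Suc i) < \<tau> (Suc i)" "\<tau> (Suc i) \<le> T"
        using sigma_tau tau_sigma by auto
      then show ?case by simp
    qed
  qed
  let ?A = "\<lambda>i. A_min a (\<sigma> i) (\<tau> i)"
  define Am where "Am = Min (?A ` {1..m})"
  have A_pos: "0 < ?A i" if i: "i \<in> {1..m}" for i
    by (rule window_min(3)[OF a_meas C0 \<sigma>_nonneg[OF i] _ \<tau>_le[OF i]]) (use i sigma_tau a_pos in auto)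
  have Am: "0 < Am" "Am \<le> ?A 1"
    using A_pos m by (auto simp: Am_def intro!: Min_le)
  have i1: "1 \<in> {1..m}" using m by simp
  define s where "s = \<sigma> 1"
  define r where "r = \<tau> 1"
  have sr: "0 \<le> s" "s < r" "r \<le> T"
    using \<sigma>_nonneg[OF i1] \<tau>_le[OF i1] sigma_tau i1 by (auto simp: s_def r_def)
  have pos: "AE t\<in>{s..r} in lebesgue. 0 < a t" using a_pos i1 by (simp add: s_def r_def)

  have meas_sub: "a \<in> borel_measurable (lebesgue_on S)" if "S \<subseteq> {0..T}" for S
    by (rule measurable_restrict_mono[OF a_meas that])
  define L where "L = Linf_norm 0 T (neg_part a)"
  have neg_meas: "(\<lambda>t. ereal \<bar>neg_part a t\<bar>) \<in> borel_measurable (lebesgue_on {0<..<T})"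
  proof -
    have "a \<in> borel_measurable (lebesgue_on {0<..<T})" by (rule meas_sub) auto
    then show ?thesis unfolding neg_part_def by measurable
  qed
  have L0: "0 \<le> L"
  proof -
    have "emeasure (lebesgue_on {0<..<T}) (space (lebesgue_on {0<..<T})) \<noteq> 0"
      using T_pos by (simp add: emeasure_restrict_space)
    then have "esssup (lebesgue_on {0<..<T}) (\<lambda>_. 0 :: ereal) = 0" by (rule esssup_const)
    moreover have "esssup (lebesgue_on {0<..<T}) (\<lambda>_. 0 :: ereal) \<le> L"
      unfolding L_def Linf_norm_def by (rule esssup_mono) auto
    ultimately show ?thesis by simp
  qed
  have "L \<le> ereal C0"
    unfolding L_def Linf_norm_def
  proof (rule esssup_I[OF neg_meas])
    have "AE t in lebesgue. t \<in> {0<..<T} \<longrightarrow> ereal \<bar>neg_part a t\<bar> \<le> ereal C0"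
      using C0 by eventually_elim (auto simp: neg_part_def min_def split: if_splits)
    then show "AE t in lebesgue_on {0<..<T}. ereal \<bar>neg_part a t\<bar> \<le> ereal C0"
      by (subst AE_restrict_space_iff) auto
  qed
  then obtain N where N: "L = ereal N" "0 \<le> N" using L0 by (cases L) auto
  have lower: "AE t\<in>{0<..<T} in lebesgue. - N \<le> a t"
  proof -
    have "AE t in lebesgue_on {0<..<T}. ereal \<bar>neg_part a t\<bar> \<le> L"
      unfolding L_def Linf_norm_def by (rule esssup_AE)
    then have "AE t in lebesgue. t \<in> {0<..<T} \<longrightarrow> ereal \<bar>neg_part a t\<bar> \<le> L"
      by (subst (asm) AE_restrict_space_iff) auto
    then show ?thesis
      by eventually_elim (auto simp: N(1) neg_part_def min_def split: if_splits)
  qed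

  \<comment> \<open>\<open>b\<close> equals \<open>a\<close> almost everywhere and satisfies the bounds at every point\<close>
  define C where "C = max C0 N"
  define lo where "lo t = (if t \<in> {s..r} then 0 else - N)" for t
  define b where "b t = max (lo t) (min C (a t))" for t
  have C: "0 \<le> C" "N \<le> C" "C0 \<le> C" using N(2) by (auto simp: C_def)
  have b_meas: "b \<in> borel_measurable (lebesgue_on {0..T})"
  proof -
    have "lo \<in> borel_measurable borel" unfolding lo_def[abs_def] by measurable
    then have "lo \<in> borel_measurable lebesgue" by (simp add: measurable_completion)
    then have "lo \<in> borel_measurable (lebesgue_on {0..T})" by (rule measurable_restrict_space1)
    then show ?thesis using a_meas unfolding b_def[abs_def] by measurable
  qed
  have ab: "AE t\<in>{0..T} in lebesgue. b t = a t"
  proof -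
    have "negligible {0, T}" by simp
    then have "AE t in lebesgue. t \<notin> {0, T}" by (simp only: negligible_iff_null_sets AE_not_in)
    with C0 lower pos show ?thesis
      by eventually_elim (use C in \<open>auto simp: b_def lo_def\<close>)
  qed
  interpret mink_system T C b g
  proof
    show "\<bar>b t\<bar> \<le> C" for t using C N(2) by (auto simp: b_def lo_def)
  qed (use T_pos b_meas g_cont g_zero g_pos in auto)
  have b_lower: "- N \<le> b t" "t \<in> {s..r} \<Longrightarrow> 0 \<le> b t" for t
    using N(2) by (auto simp: b_def lo_def)

  have b_int: "set_integrable lebesgue {x..y} b" if "0 \<le> x" "y \<le> T" for x y
  proof -
    have "b \<in> borel_measurable (lebesgue_on {x..y})"
      by (rule measurable_restrict_mono[OF b_meas]) (use that in auto)
    then show ?thesis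
      using measurable_bounded_by_integrable_imp_absolutely_integrable[of b "{x..y}" "\<lambda>_. C"] a_le that
      by auto
  qed
  have ind_meas: "(\<lambda>t. indicator S t *\<^sub>R f t) \<in> borel_measurable lebesgue"
    if "f \<in> borel_measurable (lebesgue_on S)" "S \<in> sets lebesgue" for S and f :: "real \<Rightarrow> real"
    using that by (simp add: borel_measurable_restrict_space_iff)
  have mean: "integral {0..T} b < 0"
  proof -
    have "(LINT t:{0..T}|lebesgue. a t) = (LINT t:{0..T}|lebesgue. b t)"
      unfolding set_lebesgue_integral_def
    proof (rule Bochner_Integration.integral_cong_AE)
      show "(\<lambda>t. indicator {0..T} t *\<^sub>R a t) \<in> borel_measurable lebesgue"
        by (rule ind_meas[OF meas_sub]) auto
      show "(\<lambda>t. indicator {0..T} t *\<^sub>R b t) \<in> borel_measurable lebesgue"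
        by (rule ind_meas[OF b_meas]) simp
      show "AE t in lebesgue. indicator {0..T} t *\<^sub>R a t = indicator {0..T} t *\<^sub>R b t"
        using ab by eventually_elim (auto simp: indicator_def)
    qed
    also have "\<dots> = integral {0..T} b"
      by (rule set_lebesgue_integral_eq_integral(2)[OF b_int]) auto
    finally show ?thesis using a_mean by simp
  qed
  \<comment> \<open>on the window \<open>b\<close> agrees with \<open>\<bar>a\<bar>\<close>, so the norms that define \<open>A_min\<close> are integrals of \<open>b\<close>\<close>
  have window: "Am \<le> integral {t..t + (r - s) / 4} b" if t: "s \<le> t" "t + (r - s) / 4 \<le> r" for t
  proof -
    let ?t' = "t + (r - s) / 4"
    have "L1_norm t ?t' a \<in> window_norms a s r"
      unfolding window_norms_def using t sr by fastforce
    then have "?A 1 \<le> L1_norm t ?t' a"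
      using window_min(2)[OF meas_sub[OF order_refl] C0 sr pos] by (simp add: s_def r_def)
    also have "L1_norm t ?t' a = (LINT x:{t<..<?t'}|lebesgue. b x)"
      unfolding L1_norm_def set_lebesgue_integral_def
    proof (rule Bochner_Integration.integral_cong_AE)
      have "a \<in> borel_measurable (lebesgue_on {t<..<?t'})" by (rule meas_sub) (use t sr in auto)
      then have "(\<lambda>x. \<bar>a x\<bar>) \<in> borel_measurable (lebesgue_on {t<..<?t'})" by measurable
      then show "(\<lambda>x. indicator {t<..<?t'} x *\<^sub>R \<bar>a x\<bar>) \<in> borel_measurable lebesgue"
        by (rule ind_meas) simp
      have "b \<in> borel_measurable (lebesgue_on {t<..<?t'})"
        by (rule measurable_restrict_mono[OF b_meas]) (use t sr in auto)
      then show "(\<lambda>x. indicator {t<..<?t'} x *\<^sub>R b x) \<in> borel_measurable lebesgue"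
        by (rule ind_meas) simp
      show "AE x in lebesgue. indicator {t<..<?t'} x *\<^sub>R \<bar>a x\<bar> = indicator {t<..<?t'} x *\<^sub>R b x"
        using ab pos
      proof eventually_elim
        fix x assume x: "x \<in> {0..T} \<longrightarrow> b x = a x" "x \<in> {s..r} \<longrightarrow> 0 < a x"
        show "indicator {t<..<?t'} x *\<^sub>R \<bar>a x\<bar> = indicator {t<..<?t'} x *\<^sub>R b x"
        proof (cases "x \<in> {t<..<?t'}")
          case True
          then have "x \<in> {0..T}" "x \<in> {s..r}" using t sr by auto
          then show ?thesis using x by simp
        qed simp
      qed
    qed
    also have "\<dots> = integral {t<..<?t'} b"
      by (rule set_lebesgue_integral_eq_integral(2), rule set_integrable_subset[OF b_int[of t ?t']])
        (use t sr in auto)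
    also have "\<dots> = integral {t..?t'} b" by (simp add: integral_open_interval_real)
    finally show ?thesis using Am(2) by simp
  qed

  have "ereal (N / Am) < Liminf at_top (\<lambda>u. ereal (g u / integral {0..u} g))"
    using g_growth Am(1) unfolding L_def[symmetric] Am_def[symmetric] N(1) by simp
  then obtain c where c: "ereal (N / Am) < ereal c" "ereal c < Liminf at_top (\<lambda>u. ereal (g u / integral {0..u} g))"
    using ereal_dense2 by blast
  have c_N: "N < c * Am" using c(1) Am(1) by (simp add: field_simps)
  have c_pos: "0 < c" using c(1) N(2) Am(1) by (smt (verit) divide_nonneg_pos ereal_less(2) less_ereal.simps(1))
  have "\<forall>\<^sub>F u in at_top. ereal c < ereal (g u / integral {0..u} g)" by (rule less_LiminfD[OF c(2)])
  then obtain R1 where R1: "\<And>u. R1 \<le> u \<Longrightarrow> c < g u / integral {0..u} g"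
    unfolding eventually_at_top_linorder by auto
  have growth: "c * integral {0..u} g \<le> g u" if "R1 \<le> u" for u
  proof -
    have "0 \<le> integral {0..u} g"
      by (rule Henstock_Kurzweil_Integration.integral_nonneg)
        (auto intro!: integrable_continuous_real continuous_on_subset[OF g_cont] simp: g_nonneg)
    moreover have "integral {0..u} g \<noteq> 0" using R1[OF that] c_pos by auto
    ultimately have "0 < integral {0..u} g" by simp
    then show ?thesis using R1[OF that] by (simp add: field_simps)
  qed
  obtain R2 where R2: "0 < R2" "mono_on {R2..} g" using g_mono by blast
  obtain \<rho> where \<rho>: "0 < \<rho>"
    "\<And>u w c. trajectory u w \<Longrightarrow> norm (u 0, w 0) < \<rho> \<Longrightarrow> (u 0, w 0) \<noteq> 0 \<Longrightarrow> 0 \<le> c \<Longrightarrow>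
      u T - u 0 = - c * w 0 \<or> w 0 = 0 \<Longrightarrow> w T - w 0 = - c * u 0 \<Longrightarrow> False"
    using no_small_trajectory[OF g_superlinear g_regular mean] by metis
  obtain R where R: "0 < R"
    "\<And>u w. trajectory u w \<Longrightarrow> u T = u 0 \<or> w 0 = 0 \<Longrightarrow> w 0 \<le> w T \<Longrightarrow> norm (u 0, w 0) < R"
    using no_large_trajectory[OF N(2) b_lower(1) sr b_lower(2) Am(1) window c_N growth R2] by metis
  define \<Phi> :: "(real \<times> real) \<times> (real \<times> real) \<Rightarrow> real \<times> real" where
    "\<Phi> = (if B = periodic_op T then (\<lambda>(z, y). y - z) else (\<lambda>(z, y). (snd z, snd y)))"
  obtain u w where traj: "trajectory u w" and nz: "(u 0, w 0) \<noteq> 0"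
    and zero: "\<Phi> ((u 0, w 0), (u T, w T)) = 0"
  proof (rule boundary_value_trajectory[of \<Phi> \<rho> R])
    show "\<Phi> = (\<lambda>(z, y). y - z) \<or> \<Phi> = (\<lambda>(z, y). (snd z, snd y))" by (simp add: \<Phi>_def)
    show "0 < \<rho>" "0 < R" by fact+
    fix u w
    assume traj: "trajectory u w"
    show False if "norm (u 0, w 0) < \<rho>" "(u 0, w 0) \<noteq> 0" "0 \<le> c"
      "u T - u 0 = - c * w 0 \<or> w 0 = 0" "w T - w 0 = - c * u 0" for c
      using \<rho>(2)[OF traj that] .
    show "norm (u 0, w 0) < R" if "u T = u 0 \<or> w 0 = 0" "w 0 \<le> w T"
      using R(2)[OF traj that] .
  qed blast
  have ends: "0 \<in> {0..T}" "T \<in> {0..T}" using T_pos by auto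
  have bc: "B = periodic_op T \<and> u T = u 0 \<and> w T = w 0 \<or> B = neumann_op T \<and> w 0 = 0 \<and> w T = 0"
    using zero B by (auto simp: \<Phi>_def zero_prod_def split: if_splits)
  then have bc': "u T = u 0 \<or> w 0 = 0" "w 0 \<le> w T" "u T = u 0 \<and> w T = w 0 \<or> w 0 = 0 \<and> w T = 0" by auto
  have nonneg: "0 \<le> u t" if "t \<in> {0..T}" for t by (rule traj_nonneg[OF traj bc'(2,1) that])
  have "0 < u t" if "t \<in> {0..T}" for t
    by (rule traj_positive[OF traj g_superlinear nonneg bc'(3) nz that])
  moreover have "B u = (0, 0)"
    using bc Icc_deriv_trajectory[OF traj ends(1)] Icc_deriv_trajectory[OF traj ends(2)]
    by (auto simp: periodic_op_def neumann_op_def mink_slope_sgn)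
  ultimately have "is_positive_solution T B a g u"
    by (rule trajectory_is_positive_solution[OF traj _ _ ab])
  then show ?thesis by blast
qed

end
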